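(* Let $U\subseteq\widetilde{\mathbb{R}}^n$ be a non-empty sharply open set and $\emptyset\ne K\subseteq U$ functionally compact. For $n\in\mathbb{N}_{>0}$ set $A_n:=\{f\in\mathcal{GD}_K(U) : \frac{1}{\mathrm{d}\varepsilon^n}\|f\|_n\approx0\}$, and let $u\in\mathcal{GD}_K(U)$. Then: (i) $V_{A_n}(u)=v_n(u)-n$; (ii) the map $d_e(u,v)=\sum_{n=1}^{+\infty}e^{\min[n-v_n(u-v),\,0]-n}$ is a metric on $\mathcal{GD}_K(U)$ that is equivalent (i.e. induces the same topology) to the metric $d_2(u,v)=\sum_{n=1}^{+\infty}2^{-n}\min\{\mathcal{P}_{A_n}(u-v),1\}$.
   Context: Generalized numbers: $I=(0,1]$; nets are indexed by $\varepsilon\in I$; "for $\varepsilon$ small" means for all $\varepsilon\in(0,\varepsilon_0]$ for some $\varepsilon_0\in I$. A net $(x_\varepsilon)$ in $\mathbb{R}^n$ is moderate if $|x_\varepsilon|=O(\varepsilon^{-N})$ as $\varepsilon\to0$ for some $N\in\mathbb{N}$; $(x_\varepsilon)\sim(y_\varepsilon)$ iff $|x_\varepsilon-y_\varepsilon|=O(\varepsilon^m)$ for all $m\in\mathbb{N}$. $\widetilde{\mathbb{R}}^n$ is the set of classes $[x_\varepsilon]$ of moderate nets in $\mathbb{R}^n$; $\widetilde{\mathbb{R}}$ is a ring. $x\le y$ iff there are representatives with $x_\varepsilon\le y_\varepsilon$ for $\varepsilon$ small; $x<y$ means $x\le y$ and $y-x$ invertible. $|[x_\varepsilon]|:=[|x_\varepsilon|]$,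 $\mathrm{d}\varepsilon^q:=[\varepsilon^q]$ for $q\in\mathbb{R}$; $x\approx0$ means $|x|\le r$ for all $r\in\mathbb{R}_{>0}$. The sharp topology on $\widetilde{\mathbb{R}}^n$ is generated by the balls $\{y : |y-x|<\rho\}$, $\rho\in\widetilde{\mathbb{R}}_{>0}$. Sets: for a net $(A_\varepsilon)$ of subsets of $\mathbb{R}^n$, $[A_\varepsilon]:=\{[x_\varepsilon] : x_\varepsilon\in A_\varepsilon\text{ for }\varepsilon\text{ small}\}$ and $\langle A_\varepsilon\rangle$ is the set of $[x_\varepsilon]$ such that for every representative one has $x_\varepsilon\in A_\varepsilon$ for $\varepsilon$ small. $K\subseteq\widetilde{\mathbb{R}}^n$ is functionally compact if $K=[K_\varepsilon]$ for a net of compact sets $K_\varepsilon\subseteq\mathbb{R}^n$ with $\sup_{x\in K_\varepsilon}|x|\le\varepsilon^{-N}$ for $\varepsilon$ small, for some $N\in\mathbb{R}_{>0}$. Generalized smooth functions: $f:X\to Y$ ($X\subseteq\widetilde{\mathbb{R}}^n$, $Y\subseteq\widetilde{\mathbb{R}}^d$) is in $\mathcal{G}^\infty(X,Y)$ if there is a net $u_\varepsilon\in C^\infty(\Omega_\varepsilon,\mathbb{R}^d)$ ($\Omega_\varepsilon$ open) defining $f$: $X\subseteq\langle\Omega_\varepsilon\rangle$, $f([x_\varepsilon])=[u_\varepsilon(x_\varepsilon)]\in Y$ and $(\partial^\alpha u_\varepsilon(x_\varepsilon))$ moderate for all $[x_\varepsilon]\in X$, $\alpha\in\mathbb{N}^n$.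 If $X$ is sharply open, $\partial^\alpha f([x_\varepsilon]):=[\partial^\alpha u_\varepsilon(x_\varepsilon)]$ is independent of the defining net. Compact supports: $\mathrm{ext}(K):=\{x : \forall a\in K,\ |x-a|>0\}$. For non-empty functionally compact $K\subseteq U$, $\mathcal{GD}_K(U)$ is the $\widetilde{\mathbb{R}}$-module of $f\in\mathcal{G}^\infty(U,\widetilde{\mathbb{R}})$ having a defining net $u_\varepsilon\in C^\infty(\mathbb{R}^n,\mathbb{R})$ with $[\partial^\alpha u_\varepsilon(x_\varepsilon)]=0$ for all $\alpha\in\mathbb{N}^n$ and $[x_\varepsilon]\in\mathrm{ext}(K)$. For $m\in\mathbb{N}$, $\|f\|_m:=\max_{|\alpha|\le m}\max_{x\in K}|\partial^\alpha f(x)|\in\widetilde{\mathbb{R}}$ (the maximum over $K$ exists, and the value equals $[\max_{|\alpha|\le m}\sup_{x\in\mathbb{R}^n}|\partial^\alpha u_\varepsilon(x)|]$ for any such net). Valuations and gauges: $v([x_\varepsilon]):=\sup\{b\in\mathbb{R} : |x_\varepsilon|=O(\varepsilon^b)\}\in(-\infty,+\infty]$ for $[x_\varepsilon]\in\widetilde{\mathbb{R}}$, and $v_m(f):=v(\|f\|_m)$. For $A\subseteq\mathcal{GD}_K(U)$ and $u\in\mathcal{GD}_K(U)$: $V_A(u):=\sup\{b\in\mathbb{R} : u\in\mathrm{d}\varepsilon^b\cdot A\}$ and $\mathcal{P}_A(u):=e^{-V_A(u)}$, with $e^{-\infty}=0$. (The index $n$ in $A_n$ and in the sums is unrelated to the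 dimension $n$.) *)

theory Defs
  imports "HOL-Analysis.Analysis" "HOL-Library.Landau_Symbols"
begin

section \<open>Generalized numbers\<close>

text \<open>
  Nets indexed by the interval \<open>(0,1]\<close> are represented by functions on \<open>real\<close>, and
  ``for \<open>\<epsilon>\<close> small'' is \<open>\<forall>\<^sub>F \<epsilon> in at_right 0\<close>. Values of a net at indices outside \<open>(0,1]\<close> do not
  influence its class. The type \<open>'a gnum\<close> is the generalized version of a normed
  space \<open>'a\<close>: \<open>real gnum\<close> is the ring of generalized numbers and \<open>(real^'n) gnum\<close> the space of
  generalized points.
\<close>

definition net_bigo :: "real \<Rightarrow> (real \<Rightarrow> 'a::real_normed_vector) \<Rightarrow> bool" where
  "net_bigo b x \<longleftrightarrow> (\<lambda>\<epsilon>. norm (x \<epsilon>)) \<in> O[at_right 0](\<lambda>\<epsilon>. \<epsilon> powr b)"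

definition moderate :: "(real \<Rightarrow> 'a::real_normed_vector) \<Rightarrow> bool" where
  "moderate x \<longleftrightarrow> (\<exists>N::nat. net_bigo (- real N) x)"

definition negligible_net :: "(real \<Rightarrow> 'a::real_normed_vector) \<Rightarrow> bool" where
  "negligible_net x \<longleftrightarrow> (\<forall>m::nat. net_bigo (real m) x)"

definition net_equiv ::
    "(real \<Rightarrow> 'a::real_normed_vector) \<Rightarrow> (real \<Rightarrow> 'a) \<Rightarrow> bool" where
  "net_equiv x y \<longleftrightarrow> moderate x \<and> moderate y \<and> negligible_net (\<lambda>\<epsilon>. x \<epsilon> - y \<epsilon>)"

lemma net_bigo_zero: "net_bigo b (\<lambda>_. 0)"
  by (simp add: net_bigo_def)

lemma net_bigo_le:
  assumes "net_bigo b x" and "\<And>\<epsilon>. norm (y \<epsilon>) \<le> norm (x \<epsilon>)"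
  shows "net_bigo b y"
proof -
  have "(\<lambda>\<epsilon>. norm (y \<epsilon>)) \<in> O[at_right 0](\<lambda>\<epsilon>. norm (x \<epsilon>))"
    by (rule landau_o.big_mono) (simp add: assms)
  then show ?thesis
    using assms(1) landau_o.big_trans unfolding net_bigo_def by blast
qed

lemma net_bigo_minus: "net_bigo b x \<Longrightarrow> net_bigo b (\<lambda>\<epsilon>. - x \<epsilon>)"
  by (erule net_bigo_le) simp

lemma net_bigo_add:
  assumes "net_bigo b x" "net_bigo b y"
  shows "net_bigo b (\<lambda>\<epsilon>. x \<epsilon> + y \<epsilon>)"
proof -
  have "net_bigo b (\<lambda>\<epsilon>. norm (x \<epsilon>) + norm (y \<epsilon>))"
    using sum_in_bigo(1)[OF assms[unfolded net_bigo_def]] by (simp add: net_bigo_def)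
  then show ?thesis
    by (rule net_bigo_le) (simp add: order.trans[OF norm_triangle_ineq])
qed

lemma net_bigo_mult:
  fixes x y :: "real \<Rightarrow> 'a::real_normed_algebra"
  assumes "net_bigo b x" "net_bigo c y"
  shows "net_bigo (b + c) (\<lambda>\<epsilon>. x \<epsilon> * y \<epsilon>)"
proof -
  have "net_bigo (b + c) (\<lambda>\<epsilon>. norm (x \<epsilon>) * norm (y \<epsilon>))"
    using landau_o.big.mult[OF assms[unfolded net_bigo_def]]
    by (simp add: net_bigo_def powr_add norm_mult)
  then show ?thesis
    by (rule net_bigo_le) (simp add: norm_mult_ineq)
qed

lemma net_bigo_antimono:
  assumes "net_bigo b x" "c \<le> b"
  shows "net_bigo c x"
proof -
  have "\<forall>\<^sub>F \<epsilon> in at_right (0::real). \<epsilon> powr b \<le> \<epsilon> powr c"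
    using eventually_at_right_real[OF zero_less_one]
    by eventually_elim (auto intro!: powr_mono' simp: assms)
  then have "(\<lambda>\<epsilon>. \<epsilon> powr b) \<in> O[at_right 0](\<lambda>\<epsilon>. \<epsilon> powr c)"
    by (intro landau_o.big_mono) simp
  then show ?thesis
    using assms(1) landau_o.big_trans unfolding net_bigo_def by blast
qed

lemma moderate_const: "moderate (\<lambda>_. c)"
  unfolding moderate_def net_bigo_def by (rule exI[of _ 0]) (rule bigoI[of _ "norm c"],
    use eventually_at_right_less[of "0::real"] in \<open>eventually_elim; simp\<close>)

lemma moderate_bigo: "net_bigo b x \<Longrightarrow> moderate x"
  unfolding moderate_def
  by (rule exI[of _ "nat \<lceil>- b\<rceil>"], erule net_bigo_antimono) linarith

lemma moderate_le: "moderate x \<Longrightarrow> (\<And>\<epsilon>. norm (y \<epsilon>) \<le> norm (x \<epsilon>)) \<Longrightarrow> moderate y"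
  unfolding moderate_def using net_bigo_le by blast

lemma moderate_minus: "moderate x \<Longrightarrow> moderate (\<lambda>\<epsilon>. - x \<epsilon>)"
  by (erule moderate_le) simp

lemma moderate_add:
  assumes "moderate x" "moderate y"
  shows "moderate (\<lambda>\<epsilon>. x \<epsilon> + y \<epsilon>)"
proof -
  obtain M N :: nat where "net_bigo (- real M) x" "net_bigo (- real N) y"
    using assms unfolding moderate_def by blast
  then have "net_bigo (- real (M + N)) x" "net_bigo (- real (M + N)) y"
    by (auto elim!: net_bigo_antimono)
  then show ?thesis
    unfolding moderate_def using net_bigo_add by blast
qed

lemma moderate_mult:
  fixes x y :: "real \<Rightarrow> 'a::real_normed_algebra"
  shows "moderate x \<Longrightarrow> moderate y \<Longrightarrow> moderate (\<lambda>\<epsilon>. x \<epsilon> * y \<epsilon>)"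
  using net_bigo_mult moderate_bigo unfolding moderate_def by blast

lemma moderate_powr: "moderate (\<lambda>\<epsilon>. \<epsilon> powr b :: real)"
  by (rule moderate_bigo[of b]) (simp add: net_bigo_def)

lemma negligible_net_zero: "negligible_net (\<lambda>_. 0)"
  by (simp add: negligible_net_def net_bigo_zero)

lemma negligible_net_minus: "negligible_net x \<Longrightarrow> negligible_net (\<lambda>\<epsilon>. - x \<epsilon>)"
  by (simp add: negligible_net_def net_bigo_minus)

lemma negligible_net_add:
  "negligible_net x \<Longrightarrow> negligible_net y \<Longrightarrow> negligible_net (\<lambda>\<epsilon>. x \<epsilon> + y \<epsilon>)"
  by (simp add: negligible_net_def net_bigo_add)

lemma negligible_net_le:
  "negligible_net x \<Longrightarrow> (\<And>\<epsilon>. norm (y \<epsilon>) \<le> norm (x \<epsilon>)) \<Longrightarrow> negligible_net y"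
  unfolding negligible_net_def using net_bigo_le by blast

lemma negligible_net_bigo: "negligible_net x \<Longrightarrow> net_bigo b x"
  unfolding negligible_net_def
  by (erule allE[of _ "nat \<lceil>b\<rceil>"], erule net_bigo_antimono) linarith

lemma negligible_net_mult:
  fixes x y :: "real \<Rightarrow> 'a::{real_normed_algebra, comm_ring}"
  assumes "moderate x" "negligible_net y"
  shows "negligible_net (\<lambda>\<epsilon>. x \<epsilon> * y \<epsilon>)"
proof -
  obtain N :: nat where N: "net_bigo (- real N) x"
    using assms(1) unfolding moderate_def by blast
  show ?thesis
    unfolding negligible_net_def
  proof
    fix m :: nat
    show "net_bigo (real m) (\<lambda>\<epsilon>. x \<epsilon> * y \<epsilon>)"
      using net_bigo_mult[OF N negligible_net_bigo[OF assms(2), of "real m + real N"]] by simp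
  qed
qed

lemma net_equiv_refl: "moderate x \<Longrightarrow> net_equiv x x"
  by (simp add: net_equiv_def negligible_net_zero)

lemma part_equivp_net_equiv: "part_equivp (net_equiv :: (real \<Rightarrow> 'a::real_normed_vector) \<Rightarrow> _)"
proof (rule part_equivpI)
  show "\<exists>x. net_equiv x (x :: real \<Rightarrow> 'a)"
    using net_equiv_refl[OF moderate_const] by blast
  show "symp (net_equiv :: (real \<Rightarrow> 'a) \<Rightarrow> _)"
    by (rule sympI) (use negligible_net_minus in \<open>force simp: net_equiv_def\<close>)
  show "transp (net_equiv :: (real \<Rightarrow> 'a) \<Rightarrow> _)"
    by (rule transpI) (use negligible_net_add in \<open>force simp: net_equiv_def\<close>)
qed

quotient_type (overloaded) 'a gnum = "real \<Rightarrow> 'a::real_normed_vector" / partial: net_equiv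
  morphisms rep_gnum gclass
  by (rule part_equivp_net_equiv)

instantiation gnum :: (real_normed_vector) ab_group_add
begin

lift_definition zero_gnum :: "'a gnum" is "\<lambda>_. 0"
  by (simp add: net_equiv_refl moderate_const)

lift_definition plus_gnum :: "'a gnum \<Rightarrow> 'a gnum \<Rightarrow> 'a gnum" is "\<lambda>x y \<epsilon>. x \<epsilon> + y \<epsilon>"
  using negligible_net_add by (force simp: net_equiv_def moderate_add algebra_simps)

lift_definition uminus_gnum :: "'a gnum \<Rightarrow> 'a gnum" is "\<lambda>x \<epsilon>. - x \<epsilon>"
  using negligible_net_minus by (force simp: net_equiv_def moderate_minus)

definition minus_gnum :: "'a gnum \<Rightarrow> 'a gnum \<Rightarrow> 'a gnum" where
  "minus_gnum x y = x + - y"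

instance
proof
  fix a b c :: "'a gnum"
  show "a + b + c = a + (b + c)"
    by transfer (simp add: net_equiv_def moderate_add negligible_net_zero algebra_simps)
  show "a + b = b + a"
    by transfer (simp add: net_equiv_def moderate_add negligible_net_zero algebra_simps)
  show "0 + a = a"
    by transfer (simp add: net_equiv_refl)
  show "- a + a = 0"
    by transfer (simp add: net_equiv_refl moderate_const)
  show "a - b = a + - b"
    by (fact minus_gnum_def)
qed

end

instantiation gnum :: ("{real_normed_algebra_1, comm_ring_1}") comm_ring_1
begin

lift_definition one_gnum :: "'a gnum" is "\<lambda>_. 1"
  by (simp add: net_equiv_refl moderate_const)

lift_definition times_gnum :: "'a gnum \<Rightarrow> 'a gnum \<Rightarrow> 'a gnum" is "\<lambda>x y \<epsilon>. x \<epsilon> * y \<epsilon>"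
proof -
  fix x x' y y' :: "real \<Rightarrow> 'a"
  assume *: "net_equiv x x'" "net_equiv y y'"
  then have "negligible_net (\<lambda>\<epsilon>. x \<epsilon> * (y \<epsilon> - y' \<epsilon>))" "negligible_net (\<lambda>\<epsilon>. y' \<epsilon> * (x \<epsilon> - x' \<epsilon>))"
    by (simp_all add: net_equiv_def negligible_net_mult)
  then have "negligible_net (\<lambda>\<epsilon>. x \<epsilon> * (y \<epsilon> - y' \<epsilon>) + y' \<epsilon> * (x \<epsilon> - x' \<epsilon>))"
    by (rule negligible_net_add)
  also have "(\<lambda>\<epsilon>. x \<epsilon> * (y \<epsilon> - y' \<epsilon>) + y' \<epsilon> * (x \<epsilon> - x' \<epsilon>)) = (\<lambda>\<epsilon>. x \<epsilon> * y \<epsilon> - x' \<epsilon> * y' \<epsilon>)"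
    by (simp add: algebra_simps)
  finally show "net_equiv (\<lambda>\<epsilon>. x \<epsilon> * y \<epsilon>) (\<lambda>\<epsilon>. x' \<epsilon> * y' \<epsilon>)"
    using * by (simp add: net_equiv_def moderate_mult)
qed

lemma not_negligible_net_one: "\<not> negligible_net (\<lambda>_. 1 :: 'a)"
proof
  assume "negligible_net (\<lambda>_. 1 :: 'a)"
  then have "(\<lambda>\<epsilon>. 1 :: real) \<in> O[at_right 0](\<lambda>\<epsilon>. \<epsilon> powr 1)"
    using negligible_net_bigo[of "\<lambda>_. 1 :: 'a" 1] by (simp add: net_bigo_def)
  then obtain c where c: "\<forall>\<^sub>F \<epsilon> in at_right 0. 1 \<le> c * \<bar>\<epsilon> powr 1 :: real\<bar>"
    by (auto elim!: landau_o.bigE)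
  have "((\<lambda>\<epsilon>::real. \<bar>\<epsilon>\<bar>) \<longlongrightarrow> \<bar>0\<bar>) (at_right 0)"
    by (intro tendsto_intros)
  then have "((\<lambda>\<epsilon>::real. c * \<bar>\<epsilon>\<bar>) \<longlongrightarrow> c * 0) (at_right 0)"
    by (intro tendsto_mult_left) simp
  moreover have "\<forall>\<^sub>F \<epsilon>::real in at_right 0. 1 \<le> c * \<bar>\<epsilon>\<bar>"
    using c eventually_at_right_less[of "0::real"] by eventually_elim simp
  ultimately have "1 \<le> c * 0"
    by (intro tendsto_lowerbound) auto
  then show False
    by simp
qed

instance
proof
  fix a b c :: "'a gnum"
  show "a * b * c = a * (b * c)"
    by transfer (simp add: net_equiv_def moderate_mult negligible_net_zero algebra_simps)
  show "a * b = b * a"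
    by transfer (simp add: net_equiv_def moderate_mult negligible_net_zero algebra_simps)
  show "1 * a = a"
    by transfer (simp add: net_equiv_refl)
  show "(a + b) * c = a * c + b * c"
    by transfer
      (simp add: net_equiv_def moderate_mult moderate_add negligible_net_zero algebra_simps)
  show "(0 :: 'a gnum) \<noteq> 1"
    by transfer (use not_negligible_net_one negligible_net_minus in \<open>force simp: net_equiv_def\<close>)
qed

end

text \<open>
  The relations below are kept separate from the class operators because \<open>gless a b\<close> asks for
  \<open>b - a\<close> to be invertible and is therefore not \<open>gle a b \<and> a \<noteq> b\<close>.
\<close>

definition gle :: "real gnum \<Rightarrow> real gnum \<Rightarrow> bool" where
  "gle a b \<longleftrightarrow> (\<exists>x y. moderate x \<and> moderate y \<and> a = gclass x \<and> b = gclass y \<and>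
     (\<forall>\<^sub>F \<epsilon> in at_right 0. x \<epsilon> \<le> y \<epsilon>))"

definition gless :: "real gnum \<Rightarrow> real gnum \<Rightarrow> bool" where
  "gless a b \<longleftrightarrow> gle a b \<and> (b - a) dvd 1"

lift_definition gabs :: "'a::real_normed_vector gnum \<Rightarrow> real gnum" is "\<lambda>x \<epsilon>. norm (x \<epsilon>)"
proof -
  fix x y :: "real \<Rightarrow> 'a"
  assume *: "net_equiv x y"
  then have "negligible_net (\<lambda>\<epsilon>. norm (x \<epsilon>) - norm (y \<epsilon>))"
    by (auto simp: net_equiv_def norm_triangle_ineq3 elim!: negligible_net_le)
  then show "net_equiv (\<lambda>\<epsilon>. norm (x \<epsilon>)) (\<lambda>\<epsilon>. norm (y \<epsilon>))"
    using * moderate_le[of x "\<lambda>\<epsilon>. norm (x \<epsilon>)"] moderate_le[of y "\<lambda>\<epsilon>. norm (y \<epsilon>)"]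
    by (simp add: net_equiv_def)
qed

lift_definition gconst :: "'a::real_normed_vector \<Rightarrow> 'a gnum" is "\<lambda>c \<epsilon>. c"
  by (simp add: net_equiv_refl moderate_const)

lift_definition deps :: "real \<Rightarrow> real gnum" is "\<lambda>q \<epsilon>. \<epsilon> powr q"
  by (simp add: net_equiv_refl moderate_powr)

definition infinitesimal :: "real gnum \<Rightarrow> bool" where
  "infinitesimal a \<longleftrightarrow> (\<forall>r>0. gle (gabs a) (gconst r))"

lift_definition val :: "real gnum \<Rightarrow> ereal" is
  "\<lambda>x. SUP b\<in>{b. net_bigo b x}. ereal b"
proof -
  fix x y :: "real \<Rightarrow> real"
  assume *: "net_equiv x y"
  have "net_bigo b x \<longleftrightarrow> net_bigo b y" for b
  proof -
    have n: "net_bigo b (\<lambda>\<epsilon>. x \<epsilon> - y \<epsilon>)"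
      using * by (simp add: net_equiv_def negligible_net_bigo)
    show ?thesis
      using net_bigo_add[OF _ n, of y] net_bigo_add[OF _ net_bigo_minus[OF n], of x] by auto
  qed
  then show "(SUP b\<in>{b. net_bigo b x}. ereal b) = (SUP b\<in>{b. net_bigo b y}. ereal b)"
    by simp
qed

definition sharp_topology :: "'a::real_normed_vector gnum topology" where
  "sharp_topology =
     topology_generated_by {{y. gless (gabs (y - x)) \<rho>} |x \<rho>. gless 0 \<rho>}"


section \<open>Sets of generalized points\<close>

definition internal_set :: "(real \<Rightarrow> 'a::real_normed_vector set) \<Rightarrow> 'a gnum set" where
  "internal_set A = {gclass x |x. moderate x \<and> (\<forall>\<^sub>F \<epsilon> in at_right 0. x \<epsilon> \<in> A \<epsilon>)}"

definition strongly_internal_set :: "(real \<Rightarrow> 'a::real_normed_vector set) \<Rightarrow> 'a gnum set" where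
  "strongly_internal_set A =
     {a. \<forall>x. moderate x \<and> gclass x = a \<longrightarrow> (\<forall>\<^sub>F \<epsilon> in at_right 0. x \<epsilon> \<in> A \<epsilon>)}"

definition functionally_compact :: "'a::real_normed_vector gnum set \<Rightarrow> bool" where
  "functionally_compact K \<longleftrightarrow>
     (\<exists>A. (\<forall>\<epsilon>\<in>{0<..1}. compact (A \<epsilon>)) \<and> K = internal_set A \<and>
       (\<exists>N>0. \<forall>\<^sub>F \<epsilon> in at_right 0. \<forall>x\<in>A \<epsilon>. norm x \<le> \<epsilon> powr (- N)))"

definition ext :: "'a::real_normed_vector gnum set \<Rightarrow> 'a gnum set" where
  "ext K = {x. \<forall>a\<in>K. gless 0 (gabs (x - a))}"


section \<open>Smooth functions and partial derivatives\<close>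

definition partial_deriv ::
    "'n::finite \<Rightarrow> (real^'n \<Rightarrow> 'b::real_normed_vector) \<Rightarrow> real^'n \<Rightarrow> 'b" where
  "partial_deriv i u x = vector_derivative (\<lambda>t. u (x + t *\<^sub>R axis i 1)) (at 0)"

primrec Ck_on :: "nat \<Rightarrow> (real^'n::finite) set \<Rightarrow> (real^'n \<Rightarrow> 'b::real_normed_vector) \<Rightarrow> bool" where
  "Ck_on 0 \<Omega> u \<longleftrightarrow> continuous_on \<Omega> u"
| "Ck_on (Suc k) \<Omega> u \<longleftrightarrow>
     (\<forall>x\<in>\<Omega>. u differentiable at x) \<and> (\<forall>i. Ck_on k \<Omega> (partial_deriv i u))"

definition Cinf_on :: "(real^'n::finite) set \<Rightarrow> (real^'n \<Rightarrow> 'b::real_normed_vector) \<Rightarrow> bool" where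
  "Cinf_on \<Omega> u \<longleftrightarrow> (\<forall>k. Ck_on k \<Omega> u)"

text \<open>
  A multi-index is a function \<open>'n \<Rightarrow> nat\<close>. The index type carries no order, so the iterated partial
  derivative is taken along an arbitrary but fixed enumeration of the coordinates; for smooth
  functions the choice is immaterial.
\<close>

definition coords :: "'n::finite list" where
  "coords = (SOME is. distinct is \<and> set is = UNIV)"

definition multi_deriv ::
    "('n::finite \<Rightarrow> nat) \<Rightarrow> (real^'n \<Rightarrow> 'b::real_normed_vector) \<Rightarrow> real^'n \<Rightarrow> 'b" where
  "multi_deriv \<alpha> u = foldr (\<lambda>i. partial_deriv i ^^ \<alpha> i) coords u"

definition multi_indices :: "nat \<Rightarrow> ('n::finite \<Rightarrow> nat) set" where
  "multi_indices m = {\<alpha>. (\<Sum>i\<in>UNIV. \<alpha> i) \<le> m}"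


section \<open>Generalized smooth functions\<close>

definition defines_gsf ::
    "(real \<Rightarrow> (real^'n::finite) set) \<Rightarrow> (real \<Rightarrow> real^'n \<Rightarrow> 'b::euclidean_space) \<Rightarrow>
     (real^'n) gnum set \<Rightarrow> ((real^'n) gnum \<Rightarrow> 'b gnum) \<Rightarrow> bool" where
  "defines_gsf \<Omega> u X f \<longleftrightarrow>
     (\<forall>\<epsilon>\<in>{0<..1}. open (\<Omega> \<epsilon>) \<and> Cinf_on (\<Omega> \<epsilon>) (u \<epsilon>)) \<and>
     X \<subseteq> strongly_internal_set \<Omega> \<and>
     (\<forall>x. moderate x \<and> gclass x \<in> X \<longrightarrow>
        (\<forall>\<alpha>. moderate (\<lambda>\<epsilon>. multi_deriv \<alpha> (u \<epsilon>) (x \<epsilon>))) \<and>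
        f (gclass x) = gclass (\<lambda>\<epsilon>. u \<epsilon> (x \<epsilon>)))"

text \<open>
  Functions on a set are extensional, so that equality of HOL functions is equality on the set.
\<close>

definition GSF ::
    "(real^'n::finite) gnum set \<Rightarrow> 'b::euclidean_space gnum set \<Rightarrow>
     ((real^'n) gnum \<Rightarrow> 'b gnum) set" where
  "GSF X Y = {f \<in> X \<rightarrow>\<^sub>E Y. \<exists>\<Omega> u. defines_gsf \<Omega> u X f}"

definition gderiv ::
    "(real^'n::finite) gnum set \<Rightarrow> ('n \<Rightarrow> nat) \<Rightarrow> ((real^'n) gnum \<Rightarrow> 'b::euclidean_space gnum) \<Rightarrow>
     (real^'n) gnum \<Rightarrow> 'b gnum" where
  "gderiv U \<alpha> f a = (THE c. \<exists>\<Omega> u x. defines_gsf \<Omega> u U f \<and> moderate x \<and> a = gclass x \<and>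
     c = gclass (\<lambda>\<epsilon>. multi_deriv \<alpha> (u \<epsilon>) (x \<epsilon>)))"

definition GD ::
    "(real^'n::finite) gnum set \<Rightarrow> (real^'n) gnum set \<Rightarrow> ((real^'n) gnum \<Rightarrow> real gnum) set" where
  "GD K U = {f \<in> GSF U UNIV. \<exists>u. defines_gsf (\<lambda>_. UNIV) u U f \<and>
     (\<forall>x \<alpha>. moderate x \<and> gclass x \<in> ext K \<longrightarrow>
        net_equiv (\<lambda>\<epsilon>. multi_deriv \<alpha> (u \<epsilon>) (x \<epsilon>)) (\<lambda>_. 0))}"

definition gdiff ::
    "'a set \<Rightarrow> ('a \<Rightarrow> real gnum) \<Rightarrow> ('a \<Rightarrow> real gnum) \<Rightarrow> 'a \<Rightarrow> real gnum" where
  "gdiff U f g = (\<lambda>x\<in>U. f x - g x)"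

definition gscale :: "'a set \<Rightarrow> real gnum \<Rightarrow> ('a \<Rightarrow> real gnum) \<Rightarrow> 'a \<Rightarrow> real gnum" where
  "gscale U c f = (\<lambda>x\<in>U. c * f x)"


section \<open>Norms, valuations and gauges\<close>

text \<open>
  The order on generalized numbers is partial. The maximum over \<open>K\<close> is the greatest
  attained value; the maximum of finitely many generalized numbers is their \<open>\<epsilon>\<close>-wise maximum,
  which need not be one of them.
\<close>

definition gmax_on :: "'a set \<Rightarrow> ('a \<Rightarrow> real gnum) \<Rightarrow> real gnum" where
  "gmax_on K h = (THE c. c \<in> h ` K \<and> (\<forall>x\<in>K. gle (h x) c))"

definition gMax_finite :: "'i set \<Rightarrow> ('i \<Rightarrow> real gnum) \<Rightarrow> real gnum" where
  "gMax_finite J F = gclass (\<lambda>\<epsilon>. Max ((\<lambda>j. rep_gnum (F j) \<epsilon>) ` J))"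

definition gnorm ::
    "(real^'n::finite) gnum set \<Rightarrow> (real^'n) gnum set \<Rightarrow> nat \<Rightarrow>
     ((real^'n) gnum \<Rightarrow> real gnum) \<Rightarrow> real gnum" where
  "gnorm K U m f =
     gMax_finite (multi_indices m) (\<lambda>\<alpha>. gmax_on K (\<lambda>x. gabs (gderiv U \<alpha> f x)))"

definition gval ::
    "(real^'n::finite) gnum set \<Rightarrow> (real^'n) gnum set \<Rightarrow> nat \<Rightarrow>
     ((real^'n) gnum \<Rightarrow> real gnum) \<Rightarrow> ereal" where
  "gval K U m f = val (gnorm K U m f)"

definition set_val ::
    "'a set \<Rightarrow> ('a \<Rightarrow> real gnum) set \<Rightarrow> ('a \<Rightarrow> real gnum) \<Rightarrow> ereal" where
  "set_val U A u = (SUP b\<in>{b. u \<in> gscale U (deps b) ` A}. ereal b)"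

definition exp_ereal :: "ereal \<Rightarrow> ereal" where
  "exp_ereal x = (case x of ereal r \<Rightarrow> ereal (exp r) | PInfty \<Rightarrow> \<infinity> | MInfty \<Rightarrow> 0)"

definition gauge_val ::
    "'a set \<Rightarrow> ('a \<Rightarrow> real gnum) set \<Rightarrow> ('a \<Rightarrow> real gnum) \<Rightarrow> ereal" where
  "gauge_val U A u = exp_ereal (- set_val U A u)"

text \<open>The factor \<open>deps (- real n)\<close> is the multiplicative inverse of \<open>deps (real n)\<close>.\<close>

definition A_set ::
    "(real^'n::finite) gnum set \<Rightarrow> (real^'n) gnum set \<Rightarrow> nat \<Rightarrow>
     ((real^'n) gnum \<Rightarrow> real gnum) set" where
  "A_set K U n = {f \<in> GD K U. infinitesimal (deps (- real n) * gnorm K U n f)}"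

text \<open>
  The locale \<^locale>\<open>Metric_space\<close> requires symmetry and non-negativity on the whole type,
  hence the value 0 outside the carrier. The sums run over \<open>n = 1, 2, \<dots>\<close>.
\<close>

definition dist_e ::
    "(real^'n::finite) gnum set \<Rightarrow> (real^'n) gnum set \<Rightarrow>
     ((real^'n) gnum \<Rightarrow> real gnum) \<Rightarrow> ((real^'n) gnum \<Rightarrow> real gnum) \<Rightarrow> real" where
  "dist_e K U u v =
     (if u \<in> GD K U \<and> v \<in> GD K U then
        \<Sum>k. let n = Suc k in
          real_of_ereal (exp_ereal (min (ereal (real n) - gval K U n (gdiff U u v)) 0 - ereal (real n)))
      else 0)"

definition dist_2 ::
    "(real^'n::finite) gnum set \<Rightarrow> (real^'n) gnum set \<Rightarrow>
     ((real^'n) gnum \<Rightarrow> real gnum) \<Rightarrow> ((real^'n) gnum \<Rightarrow> real gnum) \<Rightarrow> real" where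
  "dist_2 K U u v =
     (if u \<in> GD K U \<and> v \<in> GD K U then
        \<Sum>k. let n = Suc k in
          (1 / 2) ^ n * real_of_ereal (min (gauge_val U (A_set K U n) (gdiff U u v)) 1)
      else 0)"

end

theory Submission
  imports Defs
begin

text \<open>
  A function with compact support in \<open>K\<close> is handled through a defining net \<open>u\<close>: its norm \<open>\<parallel>f\<parallel>\<^sub>m\<close> is the
  class of the maximum of \<open>\<bar>\<partial>\<^sup>\<alpha> u\<bar>\<close> over the compact sets \<open>A \<epsilon>\<close> representing \<open>K\<close>, because this maximum is
  attained. Hence \<open>u \<in> d\<epsilon>\<^sup>b A\<^sub>n\<close> means \<open>\<epsilon>\<^bsup>-n-b\<^esup> \<parallel>u\<parallel>\<^sub>n \<longlonglongrightarrow> 0\<close>, and the supremum of such \<open>b\<close> is \<open>v\<^sub>n(u) - n\<close>.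
  Consequently both metrics are sums of the same bounded pseudometrics
  \<open>min {exp (n - v\<^sub>n(u - v)), 1}\<close> with different summable weights, namely \<open>exp (- n)\<close> and \<open>2\<^bsup>-n\<^esup>\<close>, so
  they induce the same topology. They separate points since a function of the space whose norm vanishes
  on \<open>K\<close> vanishes everywhere: the mean value theorem controls it near \<open>K\<close>, the support condition elsewhere.
\<close>

section \<open>Nets\<close>

text \<open>The main obstacle is hidden in the word norm: \<open>gderiv\<close> is a definite
  description, so nothing can be computed before the derivatives are known to depend neither on the
  defining net nor on the representative of the point. Two defining nets differ negligibly in their
  values, but a small function may have a large derivative. What helps is an imbalance: second
  derivatives grow at one fixed rate near the point, whereas values are small to every order.
  Uniform information of this kind is not part of the hypotheses, which only speak of nets of
  points. It is obtained by choosing a worst point at each index; the hypothesis, applied to the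
  resulting net, then bounds all other points. The same device yields balls inside the domains and
  an attained maximum over K. The supremum in a valuation need not be attained, and infinitesimal is
  stronger than bounded. Both defects cost only an arbitrarily small part of the exponent, which a
  supremum does not notice.\<close>

lemma eventually_index: "\<forall>\<^sub>F \<epsilon> in at_right (0::real). 0 < \<epsilon> \<and> \<epsilon> < 1"
  using eventually_at_right_real[OF zero_less_one] by eventually_elim simp

lemma eventually_powr_le:
  fixes a r :: real
  assumes "a > 0" "r > 0"
  shows "\<forall>\<^sub>F \<epsilon> in at_right 0. \<epsilon> powr a \<le> r"
proof -
  have "0 < r powr (1 / a)"
    using assms by simp
  from eventually_at_right_real[OF this] show ?thesis
  proof eventually_elim
    case (elim \<epsilon>)
    then have "\<epsilon> powr a \<le> (r powr (1 / a)) powr a"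
      using assms by (intro powr_mono2) auto
    then show ?case
      using assms by (simp add: powr_powr)
  qed
qed

lemma net_bigoI:
  assumes "\<forall>\<^sub>F \<epsilon> in at_right 0. norm (x \<epsilon>) \<le> C * \<epsilon> powr b"
  shows "net_bigo b x"
  unfolding net_bigo_def by (rule bigoI[of _ C]) (use assms in simp)

lemma net_bigo_eventually_le:
  assumes "net_bigo b y" and "\<forall>\<^sub>F \<epsilon> in at_right 0. norm (x \<epsilon>) \<le> norm (y \<epsilon>)"
  shows "net_bigo b x"
proof -
  have "(\<lambda>\<epsilon>. norm (x \<epsilon>)) \<in> O[at_right 0](\<lambda>\<epsilon>. norm (y \<epsilon>))"
    by (rule landau_o.big_mono) (use assms(2) in simp)
  then show ?thesis
    using assms(1) landau_o.big_trans unfolding net_bigo_def by blast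
qed

text \<open>Giving up a part of the exponent absorbs the constant of the Landau symbol, so later
  estimates can be written with pure powers of \<epsilon>.\<close>

lemma net_bigoD:
  assumes "net_bigo b x" and "c < b"
  shows "\<forall>\<^sub>F \<epsilon> in at_right 0. norm (x \<epsilon>) \<le> \<epsilon> powr c"
proof -
  obtain C where C: "C > 0" "\<forall>\<^sub>F \<epsilon> in at_right 0. norm (x \<epsilon>) \<le> C * \<epsilon> powr b"
    using assms(1) unfolding net_bigo_def by (auto elim!: landau_o.bigE)
  have "\<forall>\<^sub>F \<epsilon> in at_right 0. \<epsilon> powr (b - c) \<le> 1 / C"
    using assms(2) C(1) by (intro eventually_powr_le) auto
  with C(2) eventually_index show ?thesis
  proof eventually_elim
    case (elim \<epsilon>)
    have "C * \<epsilon> powr b = (C * \<epsilon> powr (b - c)) * \<epsilon> powr c"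
      using elim by (simp add: powr_add[symmetric])
    also have "\<dots> \<le> 1 * \<epsilon> powr c"
      using elim C(1) by (intro mult_right_mono) (auto simp: field_simps)
    finally show ?case
      using elim by simp
  qed
qed

lemma negligible_netD:
  "negligible_net x \<Longrightarrow> \<forall>\<^sub>F \<epsilon> in at_right 0. norm (x \<epsilon>) \<le> \<epsilon> powr c"
  by (rule net_bigoD[of "c + 1"]) (auto intro: negligible_net_bigo)

lemma negligible_net_eventually_le:
  "negligible_net y \<Longrightarrow> \<forall>\<^sub>F \<epsilon> in at_right 0. norm (x \<epsilon>) \<le> norm (y \<epsilon>) \<Longrightarrow> negligible_net x"
  unfolding negligible_net_def using net_bigo_eventually_le by blast

lemma negligible_net_eventually_eq:
  "\<forall>\<^sub>F \<epsilon> in at_right 0. x \<epsilon> = y \<epsilon> \<Longrightarrow> negligible_net (\<lambda>\<epsilon>. x \<epsilon> - y \<epsilon>)"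
  by (rule negligible_net_eventually_le[OF negligible_net_zero[where 'a=real]]) simp

lemma moderate_eventually_le:
  "moderate y \<Longrightarrow> \<forall>\<^sub>F \<epsilon> in at_right 0. norm (x \<epsilon>) \<le> norm (y \<epsilon>) \<Longrightarrow> moderate x"
  unfolding moderate_def using net_bigo_eventually_le by blast

lemma moderateI_powr: "\<forall>\<^sub>F \<epsilon> in at_right 0. norm (x \<epsilon>) \<le> \<epsilon> powr b \<Longrightarrow> moderate x"
  by (rule moderate_eventually_le[OF moderate_powr[of b]]) simp

lemma moderate_obtain:
  assumes "moderate x"
  obtains N where "N > 0" "\<forall>\<^sub>F \<epsilon> in at_right 0. norm (x \<epsilon>) \<le> \<epsilon> powr (- N)"
proof -
  obtain M :: nat where "net_bigo (- real M) x"
    using assms unfolding moderate_def by blast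
  then have "\<forall>\<^sub>F \<epsilon> in at_right 0. norm (x \<epsilon>) \<le> \<epsilon> powr (- (real M + 1))"
    by (rule net_bigoD) simp
  then show ?thesis
    by (intro that[of "real M + 1"]) auto
qed

text \<open>Estimates for an arbitrary exponent usually end with a constant such as 2; this form
  accepts it.\<close>

lemma negligible_netI:
  assumes "\<And>c. \<exists>C d. d \<ge> c \<and> (\<forall>\<^sub>F \<epsilon> in at_right 0. norm (x \<epsilon>) \<le> C * \<epsilon> powr d)"
  shows "negligible_net x"
  unfolding negligible_net_def
proof
  fix m :: nat
  obtain C d where "d \<ge> real m" "\<forall>\<^sub>F \<epsilon> in at_right 0. norm (x \<epsilon>) \<le> C * \<epsilon> powr d"
    using assms by blast
  then show "net_bigo (real m) x"
    using net_bigoI net_bigo_antimono by blast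
qed

lemma negligible_imp_moderate: "negligible_net x \<Longrightarrow> moderate x"
  using moderate_bigo negligible_net_bigo by blast

lemma moderate_diff: "moderate x \<Longrightarrow> moderate y \<Longrightarrow> moderate (\<lambda>\<epsilon>. x \<epsilon> - y \<epsilon>)"
  using moderate_add[OF _ moderate_minus, of x y] by simp

lemma negligible_net_diff:
  "negligible_net x \<Longrightarrow> negligible_net y \<Longrightarrow> negligible_net (\<lambda>\<epsilon>. x \<epsilon> - y \<epsilon>)"
  using negligible_net_add[OF _ negligible_net_minus, of x y] by simp

lemma negligible_net_norm_iff: "negligible_net (\<lambda>\<epsilon>. norm (x \<epsilon>)) \<longleftrightarrow> negligible_net x"
  by (simp add: negligible_net_def net_bigo_def)

lemma moderate_norm_iff: "moderate (\<lambda>\<epsilon>. norm (x \<epsilon>)) \<longleftrightarrow> moderate x"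
  by (simp add: moderate_def net_bigo_def)

lemma moderate_sum:
  "(\<And>j. j \<in> J \<Longrightarrow> moderate (s j)) \<Longrightarrow> moderate (\<lambda>\<epsilon>. \<Sum>j\<in>J. s j \<epsilon>)"
  by (induction J rule: infinite_finite_induct) (auto simp: moderate_const moderate_add)

lemma negligible_net_sum:
  "(\<And>j. j \<in> J \<Longrightarrow> negligible_net (s j)) \<Longrightarrow> negligible_net (\<lambda>\<epsilon>. \<Sum>j\<in>J. s j \<epsilon>)"
  by (induction J rule: infinite_finite_induct) (auto simp: negligible_net_zero negligible_net_add)

section \<open>Generalized numbers on representatives\<close>

lemma net_equiv_self_iff: "net_equiv x x \<longleftrightarrow> moderate x"
  by (auto simp: net_equiv_def negligible_net_zero)

lemmas gclass_add = plus_gnum.abs_eq[unfolded net_equiv_self_iff]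
lemmas gclass_mult = times_gnum.abs_eq[unfolded net_equiv_self_iff]
lemmas gclass_uminus = uminus_gnum.abs_eq[unfolded net_equiv_self_iff]
lemmas gabs_gclass = gabs.abs_eq[unfolded net_equiv_self_iff]
lemmas val_gclass = val.abs_eq[unfolded net_equiv_self_iff]
lemmas gnum_induct = gnum.abs_induct[unfolded net_equiv_self_iff]

lemma gclass_diff: "moderate x \<Longrightarrow> moderate y \<Longrightarrow> gclass x - gclass y = gclass (\<lambda>\<epsilon>. x \<epsilon> - y \<epsilon>)"
  by (simp add: minus_gnum_def gclass_uminus gclass_add moderate_minus)

lemma gconst_eq: "gconst c = gclass (\<lambda>\<epsilon>. c)"
  by (simp add: gconst_def)

lemma gclass_eq_iff:
  "moderate x \<Longrightarrow> moderate y \<Longrightarrow> gclass x = gclass y \<longleftrightarrow> negligible_net (\<lambda>\<epsilon>. x \<epsilon> - y \<epsilon>)"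
  using Quotient_rel_abs2[OF Quotient_gnum] Quotient_rel[OF Quotient_gnum, of x y]
  by (auto simp: net_equiv_self_iff net_equiv_def)

lemma gclass_eqI:
  "moderate x \<Longrightarrow> moderate y \<Longrightarrow> \<forall>\<^sub>F \<epsilon> in at_right 0. x \<epsilon> = y \<epsilon> \<Longrightarrow> gclass x = gclass y"
  by (simp add: gclass_eq_iff negligible_net_eventually_eq)

lemma gnum_obtain:
  obtains x where "moderate x" "a = gclass x"
  by (induction a rule: gnum_induct) auto

text \<open>\<open>gMax_finite\<close> is built from the representatives picked by
  \<open>rep_gnum\<close>, which can be reached only through their equivalence with a known
  net.\<close>

lemma rep_gclass:
  assumes "moderate x"
  shows "moderate (rep_gnum (gclass x))" "negligible_net (\<lambda>\<epsilon>. rep_gnum (gclass x) \<epsilon> - x \<epsilon>)"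
proof -
  have "net_equiv (rep_gnum (gclass x)) x"
    using assms by (intro Quotient_rep_abs[OF Quotient_gnum]) (simp add: net_equiv_self_iff)
  then show "moderate (rep_gnum (gclass x))" "negligible_net (\<lambda>\<epsilon>. rep_gnum (gclass x) \<epsilon> - x \<epsilon>)"
    by (auto simp: net_equiv_def)
qed

text \<open>The order allows both representatives to be changed. Keeping given ones instead costs a
  negligible error, which may be collected on one side.\<close>

lemma gle_gclass_iff:
  assumes "moderate x" "moderate y"
  shows "gle (gclass x) (gclass y) \<longleftrightarrow>
    (\<exists>z. negligible_net z \<and> (\<forall>\<^sub>F \<epsilon> in at_right 0. x \<epsilon> \<le> y \<epsilon> + z \<epsilon>))"
proof
  assume "gle (gclass x) (gclass y)"
  then obtain x' y' where *: "moderate x'" "moderate y'" "gclass x = gclass x'"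
    "gclass y = gclass y'" "\<forall>\<^sub>F \<epsilon> in at_right 0. x' \<epsilon> \<le> y' \<epsilon>"
    unfolding gle_def by blast
  have "negligible_net (\<lambda>\<epsilon>. (x \<epsilon> - x' \<epsilon>) - (y \<epsilon> - y' \<epsilon>))"
    using * assms by (intro negligible_net_diff[of "\<lambda>\<epsilon>. x \<epsilon> - x' \<epsilon>"]) (auto simp: gclass_eq_iff)
  moreover have "\<forall>\<^sub>F \<epsilon> in at_right 0. x \<epsilon> \<le> y \<epsilon> + ((x \<epsilon> - x' \<epsilon>) - (y \<epsilon> - y' \<epsilon>))"
    using *(5) by eventually_elim simp
  ultimately show "\<exists>z. negligible_net z \<and> (\<forall>\<^sub>F \<epsilon> in at_right 0. x \<epsilon> \<le> y \<epsilon> + z \<epsilon>)"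
    by blast
next
  assume "\<exists>z. negligible_net z \<and> (\<forall>\<^sub>F \<epsilon> in at_right 0. x \<epsilon> \<le> y \<epsilon> + z \<epsilon>)"
  then obtain z where z: "negligible_net z" "\<forall>\<^sub>F \<epsilon> in at_right 0. x \<epsilon> \<le> y \<epsilon> + z \<epsilon>"
    by blast
  have "moderate (\<lambda>\<epsilon>. y \<epsilon> + z \<epsilon>)"
    by (rule moderate_add[OF assms(2) negligible_imp_moderate[OF z(1)]])
  moreover from this have "gclass y = gclass (\<lambda>\<epsilon>. y \<epsilon> + z \<epsilon>)"
    using assms negligible_net_minus[OF z(1)] by (simp add: gclass_eq_iff)
  ultimately show "gle (gclass x) (gclass y)"
    unfolding gle_def using assms(1) z(2) by blast
qed

text \<open>Needed for the uniqueness of the greatest value in \<open>gmax_on\<close>.\<close>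

lemma gle_antisym:
  assumes "gle a b" "gle b a"
  shows "a = b"
proof -
  obtain x y where xy: "moderate x" "a = gclass x" "moderate y" "b = gclass y"
    using gnum_obtain by metis
  obtain z w where zw: "negligible_net z" "\<forall>\<^sub>F \<epsilon> in at_right 0. x \<epsilon> \<le> y \<epsilon> + z \<epsilon>"
    "negligible_net w" "\<forall>\<^sub>F \<epsilon> in at_right 0. y \<epsilon> \<le> x \<epsilon> + w \<epsilon>"
    using assms xy by (auto simp: gle_gclass_iff)
  have "negligible_net (\<lambda>\<epsilon>. norm (z \<epsilon>) + norm (w \<epsilon>))"
    using zw by (intro negligible_net_add) (auto simp only: negligible_net_norm_iff)
  then have "negligible_net (\<lambda>\<epsilon>. x \<epsilon> - y \<epsilon>)"
    by (rule negligible_net_eventually_le)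
      (use zw(2,4) in \<open>eventually_elim; auto simp: abs_le_iff\<close>)
  then show ?thesis
    using xy by (simp add: gclass_eq_iff)
qed

text \<open>An inverse must be represented by a moderate net, and 1/w is moderate exactly when w
  stays above some power of \<epsilon>.\<close>

lemma gclass_dvd_one_iff:
  fixes w :: "real \<Rightarrow> real"
  assumes "moderate w"
  shows "gclass w dvd 1 \<longleftrightarrow> (\<exists>N. \<forall>\<^sub>F \<epsilon> in at_right 0. \<epsilon> powr N \<le> \<bar>w \<epsilon>\<bar>)"
proof
  assume "gclass w dvd 1"
  then obtain b where "1 = gclass w * b"
    by (auto simp: dvd_def)
  moreover obtain z where z: "moderate z" "b = gclass z"
    by (rule gnum_obtain)
  ultimately have "gclass (\<lambda>\<epsilon>. 1) = gclass (\<lambda>\<epsilon>. w \<epsilon> * z \<epsilon>)"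
    using assms by (simp add: gclass_mult one_gnum.abs_eq)
  then have "negligible_net (\<lambda>\<epsilon>. 1 - w \<epsilon> * z \<epsilon>)"
    using assms z by (simp add: gclass_eq_iff moderate_const moderate_mult)
  then have neg: "\<forall>\<^sub>F \<epsilon> in at_right 0. \<bar>1 - w \<epsilon> * z \<epsilon>\<bar> \<le> \<epsilon> powr 1"
    using negligible_netD[of _ 1] by fastforce
  obtain N where N: "N > 0" "\<forall>\<^sub>F \<epsilon> in at_right 0. \<bar>z \<epsilon>\<bar> \<le> \<epsilon> powr (- N)"
    using moderate_obtain[OF z(1)] by auto
  have "\<forall>\<^sub>F \<epsilon>::real in at_right 0. \<epsilon> powr 1 \<le> 1/2"
    by (rule eventually_powr_le) auto
  \<comment> \<open>The product of w and z is at least 1/2 in absolute value. The additional 1 in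
    the exponent absorbs this factor 1/2.\<close>
  with neg N(2) eventually_index have "\<forall>\<^sub>F \<epsilon> in at_right 0. \<epsilon> powr (N + 1) \<le> \<bar>w \<epsilon>\<bar>"
  proof eventually_elim
    case (elim \<epsilon>)
    then have "1/2 \<le> \<bar>w \<epsilon>\<bar> * \<bar>z \<epsilon>\<bar>"
      using elim by (simp add: abs_mult[symmetric])
    also have "\<dots> \<le> \<bar>w \<epsilon>\<bar> * \<epsilon> powr (- N)"
      using elim by (intro mult_left_mono) auto
    finally have "1/2 * \<epsilon> powr N \<le> \<bar>w \<epsilon>\<bar>"
      using elim by (simp add: powr_minus field_simps)
    moreover have "\<epsilon> powr (N + 1) \<le> 1/2 * \<epsilon> powr N"
      using elim by (simp add: powr_add)
    ultimately show ?case
      by linarith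
  qed
  then show "\<exists>N. \<forall>\<^sub>F \<epsilon> in at_right 0. \<epsilon> powr N \<le> \<bar>w \<epsilon>\<bar>"
    by blast
next
  assume "\<exists>N. \<forall>\<^sub>F \<epsilon> in at_right 0. \<epsilon> powr N \<le> \<bar>w \<epsilon>\<bar>"
  then obtain N where N: "\<forall>\<^sub>F \<epsilon> in at_right 0. \<epsilon> powr N \<le> \<bar>w \<epsilon>\<bar>"
    by blast
  have "\<forall>\<^sub>F \<epsilon> in at_right 0. norm (1 / w \<epsilon>) \<le> \<epsilon> powr (- N)"
    using N eventually_index
  proof eventually_elim
    case (elim \<epsilon>)
    have "1 / \<bar>w \<epsilon>\<bar> \<le> 1 / \<epsilon> powr N"
      using elim by (intro divide_left_mono mult_pos_pos) (auto intro: less_le_trans[of _ "\<epsilon> powr N"])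
    then show ?case
      by (simp add: powr_minus_divide)
  qed
  then have m: "moderate (\<lambda>\<epsilon>. 1 / w \<epsilon>)"
    by (rule moderateI_powr)
  have "\<forall>\<^sub>F \<epsilon> in at_right 0. 1 = w \<epsilon> * (1 / w \<epsilon>)"
    using N eventually_index
  proof eventually_elim
    case (elim \<epsilon>)
    then have "0 < \<epsilon> powr N" by simp
    then have "w \<epsilon> \<noteq> 0" using elim by auto
    then show ?case by simp
  qed
  then have "1 = gclass w * gclass (\<lambda>\<epsilon>. 1 / w \<epsilon>)"
    unfolding one_gnum.abs_eq gclass_mult[OF assms m]
    by (intro gclass_eqI moderate_const moderate_mult assms m)
  then show "gclass w dvd 1"
    by (rule dvdI)
qed

lemma gless_gclass_iff:
  assumes "moderate x" "moderate y"
  shows "gless (gclass x) (gclass y) \<longleftrightarrow> (\<exists>N. \<forall>\<^sub>F \<epsilon> in at_right 0. x \<epsilon> + \<epsilon> powr N \<le> y \<epsilon>)"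
proof
  assume "gless (gclass x) (gclass y)"
  then have *: "gle (gclass x) (gclass y)" "gclass (\<lambda>\<epsilon>. y \<epsilon> - x \<epsilon>) dvd 1"
    using assms by (auto simp: gless_def gclass_diff)
  obtain z where z: "negligible_net z" "\<forall>\<^sub>F \<epsilon> in at_right 0. x \<epsilon> \<le> y \<epsilon> + z \<epsilon>"
    using * assms by (auto simp: gle_gclass_iff)
  obtain N where N: "\<forall>\<^sub>F \<epsilon> in at_right 0. \<epsilon> powr N \<le> \<bar>y \<epsilon> - x \<epsilon>\<bar>"
    using * assms by (auto simp: gclass_dvd_one_iff moderate_diff)
  have "\<forall>\<^sub>F \<epsilon> in at_right 0. x \<epsilon> + \<epsilon> powr N \<le> y \<epsilon>"
    using z(2) N negligible_netD[OF z(1), of "N + 1"] eventually_index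
  proof eventually_elim
    case (elim \<epsilon>)
    \<comment> \<open>The negligible error is smaller than the lower bound for the distance of x and
      y, so the difference cannot have the wrong sign.\<close>
    have "\<epsilon> powr (N + 1) < 1 * \<epsilon> powr N"
      using elim by (simp add: powr_add)
    then show ?case
      using elim by (auto simp: abs_if split: if_splits)
  qed
  then show "\<exists>N. \<forall>\<^sub>F \<epsilon> in at_right 0. x \<epsilon> + \<epsilon> powr N \<le> y \<epsilon>"
    by blast
next
  assume "\<exists>N. \<forall>\<^sub>F \<epsilon> in at_right 0. x \<epsilon> + \<epsilon> powr N \<le> y \<epsilon>"
  then obtain N where N: "\<forall>\<^sub>F \<epsilon> in at_right 0. x \<epsilon> + \<epsilon> powr N \<le> y \<epsilon>"
    by blast
  have "\<forall>\<^sub>F \<epsilon> in at_right 0. x \<epsilon> \<le> y \<epsilon>"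
    using N
  proof eventually_elim
    case (elim \<epsilon>)
    have "0 \<le> \<epsilon> powr N" by simp
    then show ?case using elim by linarith
  qed
  then have "gle (gclass x) (gclass y)"
    using assms unfolding gle_def by blast
  moreover have "\<forall>\<^sub>F \<epsilon> in at_right 0. \<epsilon> powr N \<le> \<bar>y \<epsilon> - x \<epsilon>\<bar>"
    using N by eventually_elim auto
  ultimately show "gless (gclass x) (gclass y)"
    using assms by (auto simp: gless_def gclass_diff gclass_dvd_one_iff moderate_diff)
qed

lemma infinitesimal_gclass_iff:
  assumes "moderate x"
  shows "infinitesimal (gclass x) \<longleftrightarrow> (\<forall>r>0. \<forall>\<^sub>F \<epsilon> in at_right 0. \<bar>x \<epsilon>\<bar> \<le> r)"
proof (intro iffI allI impI)
  fix r :: real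
  assume "infinitesimal (gclass x)" "r > 0"
  \<comment> \<open>Half of r is kept in reserve for the negligible error of the order.\<close>
  then have "gle (gclass (\<lambda>\<epsilon>. norm (x \<epsilon>))) (gclass (\<lambda>\<epsilon>. r / 2))"
    using assms by (auto simp: infinitesimal_def gabs_gclass gconst_eq)
  then obtain z where z: "negligible_net z" "\<forall>\<^sub>F \<epsilon> in at_right 0. \<bar>x \<epsilon>\<bar> \<le> r / 2 + z \<epsilon>"
    using assms by (auto simp: gle_gclass_iff moderate_norm_iff[of x, simplified] moderate_const)
  have "\<forall>\<^sub>F \<epsilon> in at_right 0. \<epsilon> powr 1 \<le> r / 2"
    using \<open>r > 0\<close> by (intro eventually_powr_le) auto
  with z(2) negligible_netD[OF z(1), of 1] show "\<forall>\<^sub>F \<epsilon> in at_right 0. \<bar>x \<epsilon>\<bar> \<le> r"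
    by eventually_elim (auto simp: abs_le_iff)
next
  assume *: "\<forall>r>0. \<forall>\<^sub>F \<epsilon> in at_right 0. \<bar>x \<epsilon>\<bar> \<le> r"
  have "gle (gclass (\<lambda>\<epsilon>. norm (x \<epsilon>))) (gclass (\<lambda>\<epsilon>. r))" if "r > 0" for r
    unfolding gle_def using * that assms
    by (intro exI conjI) (auto simp: moderate_norm_iff[of x, simplified] moderate_const)
  then show "infinitesimal (gclass x)"
    using assms by (simp add: infinitesimal_def gabs_gclass gconst_eq)
qed

section \<open>Valuations of representatives\<close>

lemma val_gclass_ge: "moderate x \<Longrightarrow> net_bigo b x \<Longrightarrow> ereal b \<le> val (gclass x)"
  by (auto simp: val_gclass intro: SUP_upper)

text \<open>The inequality is strict because the supremum defining \<open>val\<close> need not be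
  attained.\<close>

lemma net_bigo_less_val:
  assumes "moderate x" "ereal b < val (gclass x)"
  shows "net_bigo b x"
proof -
  obtain c where "net_bigo c x" "b < c"
    using assms by (auto simp: val_gclass less_SUP_iff)
  then show ?thesis
    using net_bigo_antimono by force
qed

lemma val_eq_infinity_iff:
  assumes "moderate x"
  shows "val (gclass x) = \<infinity> \<longleftrightarrow> negligible_net x"
proof
  assume "val (gclass x) = \<infinity>"
  then show "negligible_net x"
    using assms net_bigo_less_val by (auto simp: negligible_net_def)
next
  assume "negligible_net x"
  then have "ereal b \<le> val (gclass x)" for b
    using assms by (intro val_gclass_ge negligible_net_bigo)
  then show "val (gclass x) = \<infinity>"
    by (metis ereal_top)
qed

text \<open>The counterpart of \<open>net_bigo_less_val\<close>: a lower bound for a valuation can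
  be tested on real exponents strictly below it, infinite values included.\<close>

lemma ereal_le_of_real_less:
  fixes x y :: ereal
  assumes "\<And>b. ereal b < y \<Longrightarrow> ereal b \<le> x"
  shows "y \<le> x"
proof (rule ccontr)
  assume "\<not> y \<le> x"
  then obtain b where "x < ereal b" "ereal b < y"
    using ereal_dense2[of x y] by (auto simp: not_le)
  then show False
    using assms[of b] by auto
qed

section \<open>Weighted sums of bounded pseudometrics\<close>

text \<open>The bounds are demanded on the whole type, so that summability comes without membership
  conditions. Points need only be separated by the family as a whole.\<close>

locale pseudometric_family =
  fixes M :: "'a set" and p :: "nat \<Rightarrow> 'a \<Rightarrow> 'a \<Rightarrow> real"
  assumes p_nonneg: "0 \<le> p k x y" and p_le_1: "p k x y \<le> 1"
    and p_refl: "x \<in> M \<Longrightarrow> p k x x = 0"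
    and p_sym: "x \<in> M \<Longrightarrow> y \<in> M \<Longrightarrow> p k x y = p k y x"
    and p_triangle: "x \<in> M \<Longrightarrow> y \<in> M \<Longrightarrow> z \<in> M \<Longrightarrow> p k x z \<le> p k x y + p k y z"
    and p_separating: "x \<in> M \<Longrightarrow> y \<in> M \<Longrightarrow> (\<And>k. p k x y = 0) \<Longrightarrow> x = y"
begin

text \<open>The value 0 outside \<open>M\<close> matches \<open>dist_e\<close> and
  \<open>dist_2\<close>, which makes them equal to instances of \<open>wdist\<close> as functions on
  the whole type.\<close>

definition wdist :: "(nat \<Rightarrow> real) \<Rightarrow> 'a \<Rightarrow> 'a \<Rightarrow> real" where
  "wdist c x y = (if x \<in> M \<and> y \<in> M then \<Sum>k. c k * p k x y else 0)"

lemma summable_wdist: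
  assumes "\<And>k. c k > 0" "summable c"
  shows "summable (\<lambda>k. c k * p k x y)"
  by (rule summable_comparison_test'[OF assms(2), of 0])
    (use p_nonneg p_le_1 less_imp_le[OF assms(1)] in \<open>simp add: abs_mult mult_left_le\<close>)

lemma Metric_space_wdist:
  assumes c: "\<And>k. c k > 0" "summable c"
  shows "Metric_space M (wdist c)"
proof
  have nonneg: "0 \<le> c k * p k x y" for k x y
    using p_nonneg less_imp_le[OF c(1)] by simp
  show "0 \<le> wdist c x y" for x y
    using nonneg summable_wdist[OF c] by (auto simp: wdist_def intro!: suminf_nonneg)
  show "wdist c x y = wdist c y x" for x y
    using p_sym by (auto simp: wdist_def)
  show "wdist c x y = 0 \<longleftrightarrow> x = y" if xy: "x \<in> M" "y \<in> M" for x y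
  proof
    assume "wdist c x y = 0"
    then have "\<forall>k. c k * p k x y = 0"
      using suminf_eq_zero_iff[OF summable_wdist[OF c] nonneg] xy by (simp add: wdist_def)
    then show "x = y"
      using p_separating[OF xy] c(1) by (metis less_irrefl mult_eq_0_iff)
  qed (use xy p_refl in \<open>simp add: wdist_def\<close>)
  show "wdist c x z \<le> wdist c x y + wdist c y z" if "x \<in> M" "y \<in> M" "z \<in> M" for x y z
  proof -
    have "wdist c x z \<le> (\<Sum>k. c k * p k x y + c k * p k y z)"
      using that p_triangle less_imp_le[OF c(1)] summable_wdist[OF c]
      by (auto simp: wdist_def simp flip: distrib_left intro!: suminf_le mult_left_mono)
        (simp add: distrib_left summable_add summable_wdist[OF c])
    also have "\<dots> = wdist c x y + wdist c y z"
      using that suminf_add[OF summable_wdist[OF c] summable_wdist[OF c]] by (simp add: wdist_def)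
    finally show ?thesis .
  qed
qed

text \<open>
  The tail of the \<open>c\<close>-weighted sum is small uniformly in the points; the finitely many remaining
  terms are controlled by the \<open>d\<close>-weighted sum.
\<close>

lemma wdist_dominated:
  assumes c: "\<And>k. c k > 0" "summable c" and d: "\<And>k. d k > 0" "summable d" and "e > 0"
  obtains r where "r > 0" "\<And>x y. x \<in> M \<Longrightarrow> y \<in> M \<Longrightarrow> wdist d x y < r \<Longrightarrow> wdist c x y < e"
proof -
  \<comment> \<open>As \<open>p\<close> is at most 1, the tail of the weights bounds the tail of the
    distance, so N depends on \<open>c\<close> and \<open>e\<close> alone.\<close>
  obtain N where N: "\<bar>\<Sum>k. c (k + N)\<bar> < e / 2"
    using suminf_exist_split[OF half_gt_zero[OF \<open>e > 0\<close>] c(2)] by auto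
  \<comment> \<open>The summand 1 keeps B positive when N is 0.\<close>
  define B where "B = 1 + (\<Sum>k<N. c k / d k)"
  have B: "B > 0"
    using c(1) d(1) by (simp add: B_def add_pos_nonneg sum_nonneg less_imp_le)
  have "wdist c x y < e" if xy: "x \<in> M" "y \<in> M" and less: "wdist d x y < e / (2 * B)" for x y
  proof -
    have nonneg: "0 \<le> wdist d x y"
      using Metric_space.nonneg[OF Metric_space_wdist[OF d]] .
    have summand_le: "d k * p k x y \<le> wdist d x y" for k
      using xy sum_le_suminf[OF summable_wdist[OF d], of "{k}" x y] p_nonneg less_imp_le[OF d(1)]
      by (simp add: wdist_def)
    have "wdist c x y = (\<Sum>k. c (k + N) * p (k + N) x y) + (\<Sum>k<N. c k * p k x y)"
      using xy suminf_split_initial_segment[OF summable_wdist[OF c], of x y N] by (simp add: wdist_def)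
    also have "(\<Sum>k. c (k + N) * p (k + N) x y) \<le> (\<Sum>k. c (k + N))"
      using summable_wdist[OF c] c p_le_1 p_nonneg
      by (intro suminf_le) (auto simp: summable_iff_shift[where f = "\<lambda>k. c k * p k x y"]
          summable_iff_shift mult_left_le less_imp_le)
    also have "(\<Sum>k<N. c k * p k x y) \<le> (\<Sum>k<N. c k / d k * wdist d x y)"
    proof (rule sum_mono)
      fix k
      have "c k / d k * (d k * p k x y) \<le> c k / d k * wdist d x y"
        using summand_le c(1) d(1) by (intro mult_left_mono) (auto simp: less_imp_le)
      then show "c k * p k x y \<le> c k / d k * wdist d x y"
        using d(1)[of k] by simp
    qed
    also have "\<dots> \<le> B * wdist d x y"
      using nonneg by (simp add: B_def sum_distrib_right distrib_right)
    also have "B * wdist d x y < e / 2"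
      using less B by (simp add: field_simps)
    finally show ?thesis
      using N by simp
  qed
  then show ?thesis
    using that[of "e / (2 * B)"] B \<open>e > 0\<close> by simp
qed

lemma openin_wdist_mono:
  assumes c: "\<And>k. c k > 0" "summable c" and d: "\<And>k. d k > 0" "summable d"
    and "openin (Metric_space.mtopology M (wdist c)) S"
  shows "openin (Metric_space.mtopology M (wdist d)) S"
proof -
  interpret C: Metric_space M "wdist c" by (rule Metric_space_wdist[OF c])
  interpret D: Metric_space M "wdist d" by (rule Metric_space_wdist[OF d])
  have S: "S \<subseteq> M" "\<And>x. x \<in> S \<Longrightarrow> \<exists>r>0. C.mball x r \<subseteq> S"
    using assms(5) by (auto simp: C.openin_mtopology)
  have "\<exists>r>0. D.mball x r \<subseteq> S" if "x \<in> S" for x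
  proof -
    obtain e where e: "e > 0" "C.mball x e \<subseteq> S"
      using S(2)[OF \<open>x \<in> S\<close>] by blast
    obtain r where "r > 0" "\<And>x y. x \<in> M \<Longrightarrow> y \<in> M \<Longrightarrow> wdist d x y < r \<Longrightarrow> wdist c x y < e"
      using wdist_dominated[OF c d e(1)] by blast
    then show ?thesis
      using e by (intro exI[of _ r]) (auto simp: C.mball_def D.mball_def)
  qed
  then show ?thesis
    using S by (simp add: D.openin_mtopology)
qed

lemma mtopology_wdist_eq:
  assumes "\<And>k. c k > 0" "summable c" "\<And>k. d k > 0" "summable d"
  shows "Metric_space.mtopology M (wdist c) = Metric_space.mtopology M (wdist d)"
  using openin_wdist_mono[OF assms] openin_wdist_mono[OF assms(3,4,1,2)]
  by (intro topology_eq[THEN iffD2]) blast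

end

section \<open>Sharply open sets\<close>

lemma moderate_near:
  assumes "moderate x" "\<forall>\<^sub>F \<epsilon> in at_right 0. dist (y \<epsilon>) (x \<epsilon>) \<le> \<epsilon> powr q"
  shows "moderate y"
proof -
  have "moderate (\<lambda>\<epsilon>. y \<epsilon> - x \<epsilon>)"
    using assms(2) by (intro moderateI_powr) (simp add: dist_norm)
  from moderate_add[OF this assms(1)] show ?thesis
    by simp
qed

text \<open>This extracts from the generated topology the only form in which openness is used: a
  neighbourhood whose radius is a real power of \<epsilon>, stated for nets instead of
  classes.\<close>

lemma generated_sharp_ball:
  fixes U :: "'a::real_normed_vector gnum set"
  assumes "generate_topology_on {{y. gless (gabs (y - x)) \<rho>} |x \<rho>. gless 0 \<rho>} U"
    and "moderate x" and "gclass x \<in> U"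
  shows "\<exists>q>0. \<forall>y. (\<forall>\<^sub>F \<epsilon> in at_right 0. dist (y \<epsilon>) (x \<epsilon>) \<le> \<epsilon> powr q) \<longrightarrow> gclass y \<in> U"
  using assms
proof induction
  case Empty
  then show ?case by simp
next
  case (Int a b)
  from Int.IH(1) Int.prems obtain q where
    q: "q > 0" "\<forall>y. (\<forall>\<^sub>F \<epsilon> in at_right 0. dist (y \<epsilon>) (x \<epsilon>) \<le> \<epsilon> powr q) \<longrightarrow> gclass y \<in> a"
    by auto
  from Int.IH(2) Int.prems obtain r where
    r: "\<forall>y. (\<forall>\<^sub>F \<epsilon> in at_right 0. dist (y \<epsilon>) (x \<epsilon>) \<le> \<epsilon> powr r) \<longrightarrow> gclass y \<in> b"
    by auto
  \<comment> \<open>For \<epsilon> below 1 the larger exponent gives the smaller ball.\<close>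
  have "gclass y \<in> a \<inter> b"
    if y: "\<forall>\<^sub>F \<epsilon> in at_right 0. dist (y \<epsilon>) (x \<epsilon>) \<le> \<epsilon> powr max q r" for y
  proof -
    have "\<forall>\<^sub>F \<epsilon> in at_right (0::real). \<epsilon> powr max q r \<le> \<epsilon> powr q \<and> \<epsilon> powr max q r \<le> \<epsilon> powr r"
      using eventually_index by eventually_elim (auto intro!: powr_mono')
    with y have "\<forall>\<^sub>F \<epsilon> in at_right 0. dist (y \<epsilon>) (x \<epsilon>) \<le> \<epsilon> powr q \<and> dist (y \<epsilon>) (x \<epsilon>) \<le> \<epsilon> powr r"
      by eventually_elim auto
    then show ?thesis
      using q r by (auto simp: eventually_conj_iff)
  qed
  then show ?case
    using q(1) by (intro exI[of _ "max q r"]) auto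
next
  case (UN k)
  then obtain k' where k': "k' \<in> k" "gclass x \<in> k'"
    by blast
  from UN.IH[OF k'(1) UN.prems(1) k'(2)] show ?case
    using k'(1) by blast
next
  case (Basis s)
  then obtain c \<rho> where s: "s = {y. gless (gabs (y - c)) \<rho>}"
    by blast
  obtain a r where a: "moderate a" "c = gclass a" "moderate r" "\<rho> = gclass r"
    using gnum_obtain by metis
  have iff: "gclass y \<in> s \<longleftrightarrow> (\<exists>N. \<forall>\<^sub>F \<epsilon> in at_right 0. norm (y \<epsilon> - a \<epsilon>) + \<epsilon> powr N \<le> r \<epsilon>)"
    if "moderate y" for y
  proof -
    have "moderate (\<lambda>\<epsilon>. y \<epsilon> - a \<epsilon>)"
      using that a by (intro moderate_diff)
    then show ?thesis
      using that a by (simp add: s gclass_diff gabs_gclass gless_gclass_iff moderate_norm_iff)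
  qed
  obtain N where N: "\<forall>\<^sub>F \<epsilon> in at_right 0. norm (x \<epsilon> - a \<epsilon>) + \<epsilon> powr N \<le> r \<epsilon>"
    using Basis iff by blast
  \<comment> \<open>The maximum makes q positive. The additional 1 gains a factor \<epsilon> \<le>
    1/2, so that \<open>\<epsilon> powr q\<close> fits twice into the gap
    \<open>\<epsilon> powr N\<close>: once for moving from x to y, once as the gap that remains at
    y.\<close>
  define q where "q = max N 0 + 1"
  have "gclass y \<in> s" if y: "\<forall>\<^sub>F \<epsilon> in at_right 0. dist (y \<epsilon>) (x \<epsilon>) \<le> \<epsilon> powr q" for y
  proof -
    have "\<forall>\<^sub>F \<epsilon> in at_right (0::real). \<epsilon> powr 1 \<le> 1/2"
      by (rule eventually_powr_le) auto
    then have "\<forall>\<^sub>F \<epsilon> in at_right 0. norm (y \<epsilon> - a \<epsilon>) + \<epsilon> powr q \<le> r \<epsilon>"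
      using y N eventually_index
    proof eventually_elim
      case (elim \<epsilon>)
      have "\<epsilon> powr q = \<epsilon> powr max N 0 * \<epsilon>"
        using elim by (simp add: q_def powr_add)
      also have "\<dots> \<le> \<epsilon> powr N * (1/2)"
        using elim by (intro mult_mono powr_mono') auto
      finally have "2 * \<epsilon> powr q \<le> \<epsilon> powr N"
        by simp
      moreover have "norm (y \<epsilon> - a \<epsilon>) \<le> norm (x \<epsilon> - a \<epsilon>) + dist (y \<epsilon>) (x \<epsilon>)"
        by (metis dist_norm dist_triangle add.commute)
      ultimately show ?case
        using elim by linarith
    qed
    then show ?thesis
      using iff[OF moderate_near[OF Basis(2) y]] by blast
  qed
  then show ?case
    by (intro exI[of _ q]) (auto simp: q_def)
qed

lemma sharp_open_obtain:
  fixes U :: "'a::real_normed_vector gnum set"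
  assumes "openin sharp_topology U" "moderate x" "gclass x \<in> U"
  obtains q where "q > 0"
    "\<And>y. \<forall>\<^sub>F \<epsilon> in at_right 0. dist (y \<epsilon>) (x \<epsilon>) \<le> \<epsilon> powr q \<Longrightarrow> moderate y \<and> gclass y \<in> U"
proof -
  have "generate_topology_on {{y. gless (gabs (y - x)) \<rho>} |x \<rho>. gless 0 \<rho>} U"
    using assms(1) by (simp add: sharp_topology_def openin_topology_generated_by_iff)
  from generated_sharp_ball[OF this assms(2,3)] show ?thesis
    using moderate_near[OF assms(2)] that by blast
qed

text \<open>At each index where the ball leaves the domain, let y be a point of the ball outside it.
  The net y still represents a point of U and so lies in the domain eventually; hence the
  exceptional indices stop occurring.\<close>

lemma eventually_cball_subset:
  assumes "U \<subseteq> strongly_internal_set \<Omega>"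
    and q: "\<And>y. \<forall>\<^sub>F \<epsilon> in at_right 0. dist (y \<epsilon>) (x \<epsilon>) \<le> \<epsilon> powr q \<Longrightarrow> moderate y \<and> gclass y \<in> U"
  shows "\<forall>\<^sub>F \<epsilon> in at_right 0. cball (x \<epsilon>) (\<epsilon> powr q) \<subseteq> \<Omega> \<epsilon>"
proof -
  define y where "y \<epsilon> = (if cball (x \<epsilon>) (\<epsilon> powr q) \<subseteq> \<Omega> \<epsilon> then x \<epsilon>
    else SOME z. z \<in> cball (x \<epsilon>) (\<epsilon> powr q) - \<Omega> \<epsilon>)" for \<epsilon>
  have y: "y \<epsilon> \<in> cball (x \<epsilon>) (\<epsilon> powr q) - \<Omega> \<epsilon>" if "\<not> cball (x \<epsilon>) (\<epsilon> powr q) \<subseteq> \<Omega> \<epsilon>" for \<epsilon>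
  proof -
    have "\<exists>z. z \<in> cball (x \<epsilon>) (\<epsilon> powr q) - \<Omega> \<epsilon>"
      using that by blast
    from someI_ex[OF this] show ?thesis
      using that by (simp only: y_def if_False)
  qed
  have "dist (y \<epsilon>) (x \<epsilon>) \<le> \<epsilon> powr q" for \<epsilon>
    using y[of \<epsilon>] by (cases "cball (x \<epsilon>) (\<epsilon> powr q) \<subseteq> \<Omega> \<epsilon>") (auto simp: y_def dist_commute)
  then have "moderate y \<and> gclass y \<in> U"
    using q by simp
  then have "\<forall>\<^sub>F \<epsilon> in at_right 0. y \<epsilon> \<in> \<Omega> \<epsilon>"
    using assms(1) by (auto simp: strongly_internal_set_def)
  then show ?thesis
    by eventually_elim (use y in blast)
qed

text \<open>A net of maximizers on the compact balls is itself an admissible net of points, and its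
  moderateness supplies one exponent valid on the entire balls.\<close>

lemma moderate_on_cball:
  fixes x :: "real \<Rightarrow> 'a::euclidean_space" and g :: "real \<Rightarrow> 'a \<Rightarrow> 'b::real_normed_vector"
  assumes "\<forall>\<^sub>F \<epsilon> in at_right 0. cball (x \<epsilon>) (\<epsilon> powr q) \<subseteq> \<Omega> \<epsilon>"
    and "\<forall>\<^sub>F \<epsilon> in at_right 0. continuous_on (\<Omega> \<epsilon>) (g \<epsilon>)"
    and "\<And>y. \<forall>\<^sub>F \<epsilon> in at_right 0. dist (y \<epsilon>) (x \<epsilon>) \<le> \<epsilon> powr q \<Longrightarrow> moderate (\<lambda>\<epsilon>. g \<epsilon> (y \<epsilon>))"
  obtains N where "\<forall>\<^sub>F \<epsilon> in at_right 0. \<forall>z\<in>cball (x \<epsilon>) (\<epsilon> powr q). norm (g \<epsilon> z) \<le> \<epsilon> powr (- N)"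
proof -
  have "\<forall>\<^sub>F \<epsilon> in at_right 0. \<exists>y\<in>cball (x \<epsilon>) (\<epsilon> powr q).
      \<forall>z\<in>cball (x \<epsilon>) (\<epsilon> powr q). norm (g \<epsilon> z) \<le> norm (g \<epsilon> y)"
    using assms(1,2)
  proof eventually_elim
    case (elim \<epsilon>)
    then show ?case
      by (intro continuous_attains_sup continuous_on_norm) (auto intro: continuous_on_subset)
  qed
  moreover define y where "y \<epsilon> = (SOME y. y \<in> cball (x \<epsilon>) (\<epsilon> powr q) \<and>
      (\<forall>z\<in>cball (x \<epsilon>) (\<epsilon> powr q). norm (g \<epsilon> z) \<le> norm (g \<epsilon> y)))" for \<epsilon>
  ultimately have y: "\<forall>\<^sub>F \<epsilon> in at_right 0. y \<epsilon> \<in> cball (x \<epsilon>) (\<epsilon> powr q) \<and>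
      (\<forall>z\<in>cball (x \<epsilon>) (\<epsilon> powr q). norm (g \<epsilon> z) \<le> norm (g \<epsilon> (y \<epsilon>)))"
    unfolding Bex_def y_def by (auto elim!: eventually_mono intro: someI2_ex)
  then have "\<forall>\<^sub>F \<epsilon> in at_right 0. dist (y \<epsilon>) (x \<epsilon>) \<le> \<epsilon> powr q"
    by eventually_elim (auto simp: dist_commute)
  then obtain N where "\<forall>\<^sub>F \<epsilon> in at_right 0. norm (g \<epsilon> (y \<epsilon>)) \<le> \<epsilon> powr (- N)"
    using assms(3) moderate_obtain by blast
  with y have "\<forall>\<^sub>F \<epsilon> in at_right 0. \<forall>z\<in>cball (x \<epsilon>) (\<epsilon> powr q). norm (g \<epsilon> z) \<le> \<epsilon> powr (- N)"
    by eventually_elim (auto intro: order_trans)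
  then show ?thesis
    by (rule that)
qed

section \<open>Partial derivatives\<close>

lemma has_vector_derivative_axis:
  fixes v :: "real^'n::finite \<Rightarrow> 'b::real_normed_vector"
  assumes "(v has_derivative D) (at z)"
  shows "((\<lambda>t. v (z + t *\<^sub>R axis i 1)) has_vector_derivative D (axis i 1)) (at 0)"
proof -
  have "((\<lambda>t. z + t *\<^sub>R axis i 1) has_derivative (\<lambda>t. t *\<^sub>R axis i 1)) (at (0::real))"
    by (auto intro!: derivative_eq_intros)
  from has_derivative_compose[OF this, of v D] assms
  have "((\<lambda>t. v (z + t *\<^sub>R axis i 1)) has_derivative (\<lambda>t. D (t *\<^sub>R axis i 1))) (at 0)"
    by simp
  then show ?thesis
    using linear_scale[OF has_derivative_linear[OF assms]] by (simp add: has_vector_derivative_def)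
qed

lemma partial_deriv_eq:
  fixes v :: "real^'n::finite \<Rightarrow> 'b::real_normed_vector"
  assumes "(v has_derivative D) (at z)"
  shows "partial_deriv i v z = D (axis i 1)"
  unfolding partial_deriv_def by (rule vector_derivative_at[OF has_vector_derivative_axis[OF assms]])

lemma has_real_derivative_partial_deriv:
  fixes v :: "real^'n::finite \<Rightarrow> real"
  assumes "v differentiable at z"
  shows "((\<lambda>t. v (z + t *\<^sub>R axis i 1)) has_real_derivative partial_deriv i v z) (at 0)"
proof -
  obtain D where "(v has_derivative D) (at z)"
    using assms by (auto simp: differentiable_def)
  from has_vector_derivative_axis[OF this, of i] partial_deriv_eq[OF this, of i] show ?thesis
    by (simp add: has_real_derivative_iff_has_vector_derivative)
qed

lemma Cinf_on_differentiable: "Cinf_on \<Omega> v \<Longrightarrow> z \<in> \<Omega> \<Longrightarrow> v differentiable at z"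
  unfolding Cinf_on_def by (metis Ck_on.simps(2))

lemma Cinf_on_continuous: "Cinf_on \<Omega> v \<Longrightarrow> continuous_on \<Omega> v"
  unfolding Cinf_on_def by (metis Ck_on.simps(1))

lemma Cinf_on_partial_deriv: "Cinf_on \<Omega> v \<Longrightarrow> Cinf_on \<Omega> (partial_deriv i v)"
  unfolding Cinf_on_def by (metis Ck_on.simps(2))

lemma Cinf_on_partial_deriv_funpow: "Cinf_on \<Omega> v \<Longrightarrow> Cinf_on \<Omega> ((partial_deriv i ^^ k) v)"
  by (induction k) (auto intro: Cinf_on_partial_deriv)

lemma Cinf_on_multi_deriv: "Cinf_on \<Omega> v \<Longrightarrow> Cinf_on \<Omega> (multi_deriv \<alpha> v)"
proof -
  assume "Cinf_on \<Omega> v"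
  then have "Cinf_on \<Omega> (foldr (\<lambda>i. partial_deriv i ^^ \<alpha> i) is v)" for "is"
    by (induction "is") (auto intro: Cinf_on_partial_deriv_funpow)
  then show ?thesis
    by (simp add: multi_deriv_def)
qed

section \<open>Iterated derivatives along the enumerated coordinates\<close>

lemma distinct_coords: "distinct (coords :: 'n::finite list)" and set_coords: "set (coords :: 'n list) = UNIV"
proof -
  have "\<exists>is :: 'n list. distinct is \<and> set is = UNIV"
    using finite_distinct_list[of "UNIV :: 'n set"] by auto
  then have "distinct (coords :: 'n list) \<and> set (coords :: 'n list) = UNIV"
    unfolding coords_def by (rule someI_ex)
  then show "distinct (coords :: 'n list)" "set (coords :: 'n list) = UNIV"
    by auto
qed

lemma foldr_partial_deriv_zero:
  "(\<And>i. i \<in> set is \<Longrightarrow> \<alpha> i = 0) \<Longrightarrow> foldr (\<lambda>i. partial_deriv i ^^ \<alpha> i) is v = v"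
  by (induction "is") auto

lemma foldr_id: "foldr (\<lambda>_. id) xs v = v"
  by (induction xs) auto

lemma multi_deriv_0: "multi_deriv (\<lambda>_. 0) v = v"
  by (simp add: multi_deriv_def foldr_id)

text \<open>\<open>foldr\<close> applies the coordinates at the end of the list first. If no
  coordinate before \<open>i\<close> is differentiated, the derivatives in direction
  \<open>i\<close> are therefore the outermost ones.\<close>

lemma multi_deriv_outermost:
  assumes "coords = pre @ i # suf" "\<And>j. j \<in> set pre \<Longrightarrow> \<alpha> j = 0"
  shows "multi_deriv (\<alpha>(i := Suc (\<alpha> i))) v = partial_deriv i (multi_deriv \<alpha> v)"
proof -
  have "i \<notin> set pre" "i \<notin> set suf"
    using distinct_coords[where 'n='a] unfolding assms(1) by auto
  then have "foldr (\<lambda>j. partial_deriv j ^^ (\<alpha>(i := Suc (\<alpha> i))) j) suf v = foldr (\<lambda>j. partial_deriv j ^^ \<alpha> j) suf v"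
    by (intro foldr_cong) auto
  moreover have pre: "foldr (\<lambda>j. partial_deriv j ^^ (\<alpha>(i := Suc (\<alpha> i))) j) pre w = w" for w :: "real^'a \<Rightarrow> 'b"
    using assms(2) \<open>i \<notin> set pre\<close> by (intro foldr_partial_deriv_zero) auto
  ultimately show ?thesis
    using pre assms(2) unfolding multi_deriv_def assms(1)
    by (simp add: foldr_partial_deriv_zero)
qed

text \<open>Gives access to the moderateness of the gradient, since defining nets are controlled
  through \<open>multi_deriv\<close> only.\<close>

lemma multi_deriv_axis: "multi_deriv (\<lambda>j. if j = i then 1 else 0) v = partial_deriv i v"
proof -
  obtain pre suf where "coords = pre @ i # suf"
    using set_coords[where 'n='a] by (metis UNIV_I split_list)
  from multi_deriv_outermost[OF this, of "\<lambda>_. 0" v] show ?thesis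
    by (simp add: multi_deriv_0 fun_upd_def cong: if_cong)
qed

lemma finite_multi_indices: "finite (multi_indices m :: ('n::finite \<Rightarrow> nat) set)"
proof (rule finite_subset)
  show "multi_indices m \<subseteq> (UNIV :: 'n set) \<rightarrow>\<^sub>E {..m}"
  proof
    fix \<alpha> :: "'n \<Rightarrow> nat"
    assume "\<alpha> \<in> multi_indices m"
    then have "\<alpha> i \<le> m" for i
      using member_le_sum[of i UNIV \<alpha>] by (simp add: multi_indices_def)
    then show "\<alpha> \<in> (UNIV :: 'n set) \<rightarrow>\<^sub>E {..m}"
      by (simp add: PiE_UNIV_domain)
  qed
qed (simp add: finite_PiE)

lemma zero_in_multi_indices: "(\<lambda>_. 0) \<in> multi_indices m"
  by (simp add: multi_indices_def)

section \<open>Linearity of derivatives\<close>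

lemma partial_deriv_lincomb:
  fixes v w :: "real^'n::finite \<Rightarrow> real"
  assumes "v differentiable at z" "w differentiable at z"
  shows "partial_deriv i (\<lambda>x. a * v x + b * w x) z = a * partial_deriv i v z + b * partial_deriv i w z"
proof -
  obtain D E where D: "(v has_derivative D) (at z)" and E: "(w has_derivative E) (at z)"
    using assms by (auto simp: differentiable_def)
  have "((\<lambda>x. a * v x + b * w x) has_derivative (\<lambda>h. a * D h + b * E h)) (at z)"
    by (intro derivative_intros D E)
  then show ?thesis
    by (simp add: partial_deriv_eq[OF D] partial_deriv_eq[OF E] partial_deriv_eq)
qed

lemma partial_deriv_lincomb_UNIV:
  fixes v w :: "real^'n::finite \<Rightarrow> real"
  assumes "Cinf_on UNIV v" "Cinf_on UNIV w"
  shows "partial_deriv i (\<lambda>x. a * v x + b * w x) = (\<lambda>x. a * partial_deriv i v x + b * partial_deriv i w x)"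
  using assms by (auto simp: partial_deriv_lincomb Cinf_on_differentiable)

lemma Cinf_on_lincomb:
  fixes v w :: "real^'n::finite \<Rightarrow> real"
  assumes "Cinf_on UNIV v" "Cinf_on UNIV w"
  shows "Cinf_on UNIV (\<lambda>x. a * v x + b * w x)"
proof -
  have "Ck_on k UNIV (\<lambda>x. a * v x + b * w x)" for k
    using assms
  proof (induction k arbitrary: v w)
    case 0
    then show ?case
      by (simp add: Cinf_on_continuous continuous_on_add continuous_on_mult_left)
  next
    case (Suc k)
    then show ?case
      using partial_deriv_lincomb_UNIV[OF Suc.prems]
      by (simp add: Cinf_on_differentiable[of UNIV] Cinf_on_partial_deriv differentiable_add
          differentiable_mult)
  qed
  then show ?thesis
    by (simp add: Cinf_on_def)
qed

lemma multi_deriv_lincomb: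
  fixes v w :: "real^'n::finite \<Rightarrow> real"
  assumes "Cinf_on UNIV v" "Cinf_on UNIV w"
  shows "multi_deriv \<alpha> (\<lambda>x. a * v x + b * w x) = (\<lambda>x. a * multi_deriv \<alpha> v x + b * multi_deriv \<alpha> w x)"
proof -
  define D where "D is v = foldr (\<lambda>i. partial_deriv i ^^ \<alpha> i) is v" for "is" and v :: "real^'n \<Rightarrow> real"
  have power: "(partial_deriv i ^^ k) (\<lambda>x. a * v x + b * w x) =
      (\<lambda>x. a * (partial_deriv i ^^ k) v x + b * (partial_deriv i ^^ k) w x)"
    if "Cinf_on UNIV v" "Cinf_on UNIV w" for k i v w
    using that by (induction k) (auto simp: partial_deriv_lincomb_UNIV Cinf_on_partial_deriv_funpow)
  \<comment> \<open>Smoothness of the inner derivatives is carried along, because linearity of the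
    next derivative depends on it.\<close>
  have "Cinf_on UNIV (D is v) \<and> Cinf_on UNIV (D is w) \<and>
      D is (\<lambda>x. a * v x + b * w x) = (\<lambda>x. a * D is v x + b * D is w x)" for "is"
    by (induction "is") (use assms in \<open>auto simp: D_def power Cinf_on_partial_deriv_funpow\<close>)
  then show ?thesis
    by (simp add: multi_deriv_def D_def)
qed

section \<open>Derivatives of generalized smooth functions\<close>

text \<open>
  A Landau-Kolmogorov argument: the difference quotient with step \<open>\<epsilon>\<^sup>p\<close> is negligible, and its
  distance to the derivative is \<open>O(\<epsilon>\<^bsup>p-N\<^esup>)\<close> with \<open>N\<close> independent of \<open>p\<close>.
\<close>

lemma negligible_directional_derivative:
  fixes g g1 g2 :: "real \<Rightarrow> real^'n::finite \<Rightarrow> real" and U :: "(real^'n) gnum set"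
  assumes U: "openin sharp_topology U" "U \<subseteq> strongly_internal_set \<Omega>"
    and x: "moderate x" "gclass x \<in> U"
    and g1: "\<And>\<epsilon> z. \<epsilon> \<in> {0<..1} \<Longrightarrow> z \<in> \<Omega> \<epsilon> \<Longrightarrow>
      ((\<lambda>t. g \<epsilon> (z + t *\<^sub>R axis i 1)) has_real_derivative g1 \<epsilon> z) (at 0)"
    and g2: "\<And>\<epsilon> z. \<epsilon> \<in> {0<..1} \<Longrightarrow> z \<in> \<Omega> \<epsilon> \<Longrightarrow>
      ((\<lambda>t. g1 \<epsilon> (z + t *\<^sub>R axis i 1)) has_real_derivative g2 \<epsilon> z) (at 0)"
    and cont: "\<And>\<epsilon>. \<epsilon> \<in> {0<..1} \<Longrightarrow> continuous_on (\<Omega> \<epsilon>) (g2 \<epsilon>)"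
    and negl: "\<And>y. moderate y \<Longrightarrow> gclass y \<in> U \<Longrightarrow> negligible_net (\<lambda>\<epsilon>. g \<epsilon> (y \<epsilon>))"
    and mod: "\<And>y. moderate y \<Longrightarrow> gclass y \<in> U \<Longrightarrow> moderate (\<lambda>\<epsilon>. g2 \<epsilon> (y \<epsilon>))"
  shows "negligible_net (\<lambda>\<epsilon>. g1 \<epsilon> (x \<epsilon>))"
proof -
  obtain q where q: "q > 0"
    "\<And>y. \<forall>\<^sub>F \<epsilon> in at_right 0. dist (y \<epsilon>) (x \<epsilon>) \<le> \<epsilon> powr q \<Longrightarrow> moderate y \<and> gclass y \<in> U"
    using sharp_open_obtain[OF U(1) x] by blast
  have ball: "\<forall>\<^sub>F \<epsilon> in at_right 0. cball (x \<epsilon>) (\<epsilon> powr q) \<subseteq> \<Omega> \<epsilon>"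
    using eventually_cball_subset[OF U(2) q(2)] .
  have "\<forall>\<^sub>F \<epsilon> in at_right 0. continuous_on (\<Omega> \<epsilon>) (g2 \<epsilon>)"
    using eventually_index by eventually_elim (simp add: cont)
  then obtain N where N:
    "\<forall>\<^sub>F \<epsilon> in at_right 0. \<forall>z\<in>cball (x \<epsilon>) (\<epsilon> powr q). norm (g2 \<epsilon> z) \<le> \<epsilon> powr (- N)"
    using moderate_on_cball[OF ball, of g2] mod q(2) by blast
  \<comment> \<open>The hypotheses differentiate at parameter 0 along a line based at an arbitrary
    point; this moves them to parameter t along the fixed line through \<open>z\<close>.\<close>
  have shift: "((\<lambda>t. h (z + t *\<^sub>R axis i 1)) has_real_derivative D) (at t)"
    if "((\<lambda>s. h (z + t *\<^sub>R axis i 1 + s *\<^sub>R axis i 1)) has_real_derivative D) (at 0)"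
    for h z t D
    using that DERIV_shift[of "\<lambda>t. h (z + t *\<^sub>R axis i 1)" D 0 t]
    by (simp add: scaleR_add_left algebra_simps)
  show ?thesis
  proof (rule negligible_netI)
    fix c
    \<comment> \<open>p \<ge> q keeps the end point of the step inside the ball, and p - N \<ge> c
      makes the error of the difference quotient small enough.\<close>
    define p where "p = max q (c + N)"
    define y where "y \<epsilon> = x \<epsilon> + (\<epsilon> powr p) *\<^sub>R axis i 1" for \<epsilon>
    have pq: "\<forall>\<^sub>F \<epsilon> in at_right (0::real). \<epsilon> powr p \<le> \<epsilon> powr q"
      using eventually_index by eventually_elim (auto intro!: powr_mono' simp: p_def)
    then have "\<forall>\<^sub>F \<epsilon> in at_right 0. dist (y \<epsilon>) (x \<epsilon>) \<le> \<epsilon> powr q"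
      by eventually_elim (simp add: y_def dist_norm)
    then have "negligible_net (\<lambda>\<epsilon>. g \<epsilon> (y \<epsilon>) - g \<epsilon> (x \<epsilon>))"
      using q(2) negl x by (intro negligible_net_diff) auto
    \<comment> \<open>Division by the step \<open>\<epsilon> powr p\<close> must leave
      \<open>\<epsilon> powr c\<close>.\<close>
    from negligible_netD[OF this, of "p + c"] ball N pq eventually_index
    have "\<forall>\<^sub>F \<epsilon> in at_right 0. norm (g1 \<epsilon> (x \<epsilon>)) \<le> 2 * \<epsilon> powr c"
    proof eventually_elim
      case (elim \<epsilon>)
      define h where "h = \<epsilon> powr p"
      have h: "h > 0"
        using elim by (simp add: h_def)
      have in_ball: "x \<epsilon> + t *\<^sub>R axis i 1 \<in> cball (x \<epsilon>) (\<epsilon> powr q)" if "0 \<le> t" "t \<le> h" for t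
        using that elim by (simp add: dist_norm h_def)
      have D1: "((\<lambda>t. g \<epsilon> (x \<epsilon> + t *\<^sub>R axis i 1)) has_real_derivative g1 \<epsilon> (x \<epsilon> + t *\<^sub>R axis i 1)) (at t)"
        and D2: "((\<lambda>t. g1 \<epsilon> (x \<epsilon> + t *\<^sub>R axis i 1)) has_real_derivative g2 \<epsilon> (x \<epsilon> + t *\<^sub>R axis i 1)) (at t)"
        if "0 \<le> t" "t \<le> h" for t
      proof -
        have "x \<epsilon> + t *\<^sub>R axis i 1 \<in> \<Omega> \<epsilon>" "\<epsilon> \<in> {0<..1}"
          using in_ball[OF that] elim by auto
        from shift[OF g1[OF this(2,1)]] shift[OF g2[OF this(2,1)]] 
        show "((\<lambda>t. g \<epsilon> (x \<epsilon> + t *\<^sub>R axis i 1)) has_real_derivative g1 \<epsilon> (x \<epsilon> + t *\<^sub>R axis i 1)) (at t)"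
          "((\<lambda>t. g1 \<epsilon> (x \<epsilon> + t *\<^sub>R axis i 1)) has_real_derivative g2 \<epsilon> (x \<epsilon> + t *\<^sub>R axis i 1)) (at t)" .
      qed
      \<comment> \<open>The mean value theorem controls \<open>g1\<close> only at an intermediate
        point s. A second application, to \<open>g1\<close> itself, carries the bound back to the
        parameter 0.\<close>
      obtain s where s: "0 < s" "s < h"
        "g \<epsilon> (x \<epsilon> + h *\<^sub>R axis i 1) - g \<epsilon> (x \<epsilon> + 0 *\<^sub>R axis i 1) = (h - 0) * g1 \<epsilon> (x \<epsilon> + s *\<^sub>R axis i 1)"
        using MVT2[OF h D1] by blast
      obtain r where r: "0 < r" "r < s"
        "g1 \<epsilon> (x \<epsilon> + s *\<^sub>R axis i 1) - g1 \<epsilon> (x \<epsilon> + 0 *\<^sub>R axis i 1) = (s - 0) * g2 \<epsilon> (x \<epsilon> + r *\<^sub>R axis i 1)"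
        using MVT2[OF s(1), of "\<lambda>t. g1 \<epsilon> (x \<epsilon> + t *\<^sub>R axis i 1)" "\<lambda>t. g2 \<epsilon> (x \<epsilon> + t *\<^sub>R axis i 1)"] D2 s
        by auto
      have "h * \<bar>g1 \<epsilon> (x \<epsilon> + s *\<^sub>R axis i 1)\<bar> = \<bar>g \<epsilon> (y \<epsilon>) - g \<epsilon> (x \<epsilon>)\<bar>"
        using s(3) h by (simp add: y_def h_def abs_mult)
      also have "\<dots> \<le> h * \<epsilon> powr c"
        using elim by (simp add: h_def powr_add)
      finally have *: "\<bar>g1 \<epsilon> (x \<epsilon> + s *\<^sub>R axis i 1)\<bar> \<le> \<epsilon> powr c"
        using h by simp
      have "\<bar>g1 \<epsilon> (x \<epsilon> + s *\<^sub>R axis i 1) - g1 \<epsilon> (x \<epsilon>)\<bar> \<le> h * \<epsilon> powr (- N)"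
        using r s elim in_ball[of r] by (auto simp: abs_mult intro!: mult_mono)
      also have "\<dots> = \<epsilon> powr (p - N)"
        by (simp add: h_def powr_diff powr_minus_divide)
      also have "\<dots> \<le> \<epsilon> powr c"
        using elim by (intro powr_mono') (auto simp: p_def)
      finally show ?case
        using * by (auto simp: abs_le_iff)
    qed
    then show "\<exists>C d. d \<ge> c \<and> (\<forall>\<^sub>F \<epsilon> in at_right 0. norm (g1 \<epsilon> (x \<epsilon>)) \<le> C * \<epsilon> powr d)"
      by blast
  qed
qed

text \<open>Two defining nets of one function have different domains; their difference is smooth on
  the intersection.\<close>

lemma strongly_internal_set_Int:
  "strongly_internal_set A \<inter> strongly_internal_set B = strongly_internal_set (\<lambda>\<epsilon>. A \<epsilon> \<inter> B \<epsilon>)"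
  by (auto simp: strongly_internal_set_def eventually_conj_iff)

text \<open>
  The induction peels the derivatives off from the outside, so that the second derivative required
  by the previous lemma is again a \<^const>\<open>multi_deriv\<close> and mixed partials never have to be commuted.
\<close>

lemma multi_deriv_defining_net_unique:
  fixes U :: "(real^'n::finite) gnum set" and f :: "(real^'n) gnum \<Rightarrow> real gnum"
  assumes "openin sharp_topology U" "defines_gsf \<Omega> u U f" "defines_gsf \<Omega>' u' U f"
    and "moderate x" "gclass x \<in> U"
  shows "negligible_net (\<lambda>\<epsilon>. multi_deriv \<alpha> (u \<epsilon>) (x \<epsilon>) - multi_deriv \<alpha> (u' \<epsilon>) (x \<epsilon>))"
proof -
  define W where "W \<alpha> \<epsilon> z = multi_deriv \<alpha> (u \<epsilon>) z - multi_deriv \<alpha> (u' \<epsilon>) z" for \<alpha> \<epsilon> z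
  define \<Omega>'' where "\<Omega>'' \<epsilon> = \<Omega> \<epsilon> \<inter> \<Omega>' \<epsilon>" for \<epsilon>
  note def = assms(2,3)[unfolded defines_gsf_def]
  have U: "U \<subseteq> strongly_internal_set \<Omega>''"
    using def unfolding \<Omega>''_def strongly_internal_set_Int[symmetric] by blast
  have Cinf: "Cinf_on (\<Omega> \<epsilon>) (multi_deriv \<alpha> (u \<epsilon>))" "Cinf_on (\<Omega>' \<epsilon>) (multi_deriv \<alpha> (u' \<epsilon>))"
    if "\<epsilon> \<in> {0<..1}" for \<alpha> \<epsilon>
    using def that by (auto intro!: Cinf_on_multi_deriv)
  have mod: "moderate (\<lambda>\<epsilon>. W \<alpha> \<epsilon> (y \<epsilon>))" if "moderate y" "gclass y \<in> U" for \<alpha> y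
    using def that unfolding W_def by (intro moderate_diff) auto
  \<comment> \<open>\<open>pre\<close> lists coordinates in which \<alpha> must vanish. It is all of
    \<open>coords\<close> in the base case, where \<alpha> = 0, and shrinks to the empty list, which
    admits every multi-index.\<close>
  have "\<forall>\<alpha> y. (\<forall>j\<in>set pre. \<alpha> j = 0) \<longrightarrow> moderate y \<longrightarrow> gclass y \<in> U \<longrightarrow> negligible_net (\<lambda>\<epsilon>. W \<alpha> \<epsilon> (y \<epsilon>))"
    if "coords = pre @ suf" for pre suf
    using that
  proof (induction suf arbitrary: pre)
    case Nil
    then have *: "set pre = UNIV"
      using set_coords by (metis append_Nil2)
    show ?case
    proof (intro allI impI)
      fix \<alpha> :: "'n \<Rightarrow> nat" and y
      assume "\<forall>j\<in>set pre. \<alpha> j = 0" and y: "moderate y" "gclass y \<in> U"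
      then have \<alpha>: "\<alpha> = (\<lambda>_. 0)"
        using * by auto
      have "moderate (\<lambda>\<epsilon>. multi_deriv \<alpha> (u \<epsilon>) (y \<epsilon>))" "moderate (\<lambda>\<epsilon>. multi_deriv \<alpha> (u' \<epsilon>) (y \<epsilon>))"
        "f (gclass y) = gclass (\<lambda>\<epsilon>. u \<epsilon> (y \<epsilon>))" "f (gclass y) = gclass (\<lambda>\<epsilon>. u' \<epsilon> (y \<epsilon>))"
        using def y by blast+
      then show "negligible_net (\<lambda>\<epsilon>. W \<alpha> \<epsilon> (y \<epsilon>))"
        by (simp add: W_def \<alpha> multi_deriv_0 flip: gclass_eq_iff)
    qed
  next
    case (Cons i suf)
    \<comment> \<open>The inner induction is on the order k in the coordinate \<open>i\<close>; for
      k = 0 this coordinate joins the vanishing ones.\<close>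
    have "negligible_net (\<lambda>\<epsilon>. W \<alpha> \<epsilon> (y \<epsilon>))"
      if "\<forall>j\<in>set pre. \<alpha> j = 0" "moderate y" "gclass y \<in> U" "\<alpha> i = k" for \<alpha> y k
      using that
    proof (induction k arbitrary: \<alpha> y)
      case 0
      then show ?case
        using Cons.IH[of "pre @ [i]"] Cons.prems by auto
    next
      case (Suc k)
      \<comment> \<open>\<open>W \<beta>\<close>, \<open>W \<alpha>\<close> and
        \<open>W \<gamma>\<close> are consecutive derivatives in direction \<open>i\<close>: the
        first is negligible by induction, the last is moderate, and the middle one is the
        target.\<close>
      define \<beta> where "\<beta> = \<alpha>(i := k)"
      define \<gamma> where "\<gamma> = \<alpha>(i := Suc (\<alpha> i))"
      have "i \<notin> set pre"
        using distinct_coords[where 'n='n] unfolding Cons.prems by auto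
      then have zero: "\<And>j. j \<in> set pre \<Longrightarrow> \<alpha> j = 0" "\<And>j. j \<in> set pre \<Longrightarrow> \<beta> j = 0"
        using Suc by (auto simp: \<beta>_def)
      have \<alpha>: "multi_deriv \<alpha> v = partial_deriv i (multi_deriv \<beta> v)"
        and \<gamma>: "multi_deriv \<gamma> v = partial_deriv i (multi_deriv \<alpha> v)" for v :: "real^'n \<Rightarrow> real"
        using multi_deriv_outermost[where \<alpha> = \<beta> and v = v, OF Cons.prems zero(2)]
          multi_deriv_outermost[where \<alpha> = \<alpha> and v = v, OF Cons.prems zero(1)] Suc.prems(4)
        by (auto simp: \<beta>_def \<gamma>_def fun_upd_idem)
      show ?case
      proof (rule negligible_directional_derivative[OF assms(1) U, where g = "W \<beta>" and ?g2.0 = "W \<gamma>" and i = i])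
        fix \<epsilon> :: real and z
        assume \<epsilon>: "\<epsilon> \<in> {0<..1}"
        show "continuous_on (\<Omega>'' \<epsilon>) (W \<gamma> \<epsilon>)"
          unfolding W_def \<Omega>''_def using Cinf[OF \<epsilon>, of \<gamma>]
          by (intro continuous_intros) (auto dest!: Cinf_on_continuous intro: continuous_on_subset)
        assume "z \<in> \<Omega>'' \<epsilon>"
        then have "multi_deriv \<delta> (u \<epsilon>) differentiable at z" "multi_deriv \<delta> (u' \<epsilon>) differentiable at z" for \<delta>
          using Cinf[OF \<epsilon>] Cinf_on_differentiable unfolding \<Omega>''_def by blast+
        note diff = this
        have D: "((\<lambda>t. multi_deriv \<delta> (u \<epsilon>) (z + t *\<^sub>R axis i 1) - multi_deriv \<delta> (u' \<epsilon>) (z + t *\<^sub>R axis i 1))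
            has_real_derivative partial_deriv i (multi_deriv \<delta> (u \<epsilon>)) z - partial_deriv i (multi_deriv \<delta> (u' \<epsilon>)) z) (at 0)" for \<delta>
          by (rule DERIV_diff[OF has_real_derivative_partial_deriv[OF diff(1)] has_real_derivative_partial_deriv[OF diff(2)]])
        show "((\<lambda>t. W \<beta> \<epsilon> (z + t *\<^sub>R axis i 1)) has_real_derivative W \<alpha> \<epsilon> z) (at 0)"
          "((\<lambda>t. W \<alpha> \<epsilon> (z + t *\<^sub>R axis i 1)) has_real_derivative W \<gamma> \<epsilon> z) (at 0)"
          unfolding W_def using D[of \<beta>, folded \<alpha>] D[of \<alpha>, folded \<gamma>] .
      next
        fix y
        assume y: "moderate y" "gclass y \<in> U"
        show "moderate (\<lambda>\<epsilon>. W \<gamma> \<epsilon> (y \<epsilon>))"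
          using mod y .
        show "negligible_net (\<lambda>\<epsilon>. W \<beta> \<epsilon> (y \<epsilon>))"
        proof (rule Suc.IH)
          show "\<beta> i = k"
            by (simp add: \<beta>_def)
        qed (use y zero(2) in auto)
      qed (use Suc.prems in auto)
    qed
    then show ?case
      by blast
  qed
  from this[of "[]" coords] show ?thesis
    using assms by (simp add: W_def)
qed

section \<open>Translation of defining nets\<close>

lemma partial_deriv_shift: "partial_deriv i (\<lambda>z. v (z + d)) = (\<lambda>z. partial_deriv i v (z + d))"
  by (rule ext) (simp add: partial_deriv_def algebra_simps)

lemma multi_deriv_shift: "multi_deriv \<alpha> (\<lambda>z. v (z + d)) = (\<lambda>z. multi_deriv \<alpha> v (z + d))"
proof -
  have power: "(partial_deriv i ^^ k) (\<lambda>z. v (z + d)) = (\<lambda>z. (partial_deriv i ^^ k) v (z + d))" for i k v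
    by (induction k) (simp_all add: partial_deriv_shift)
  have "foldr (\<lambda>i. partial_deriv i ^^ \<alpha> i) is (\<lambda>z. v (z + d)) =
      (\<lambda>z. foldr (\<lambda>i. partial_deriv i ^^ \<alpha> i) is v (z + d))" for "is"
    by (induction "is") (simp_all add: power)
  then show ?thesis
    by (simp add: multi_deriv_def)
qed

lemma Cinf_on_shift:
  assumes "Cinf_on \<Omega> v"
  shows "Cinf_on {z. z + d \<in> \<Omega>} (\<lambda>z. v (z + d))"
proof -
  have "Ck_on k {z. z + d \<in> \<Omega>} (\<lambda>z. v (z + d))" if "Ck_on k \<Omega> v" for k
    using that
  proof (induction k arbitrary: v)
    case 0
    then show ?case
      by (auto intro!: continuous_on_compose2[of \<Omega> v] continuous_intros)
  next
    case (Suc k)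
    have "(\<lambda>z. v (z + d)) differentiable at z" if "z + d \<in> \<Omega>" for z
    proof (rule differentiable_compose[of v])
      show "v differentiable at (z + d)"
        using Suc.prems that by simp
    qed (simp add: differentiable_add)
    with Suc show ?case
      by (simp add: partial_deriv_shift)
  qed
  then show ?thesis
    using assms by (simp add: Cinf_on_def)
qed

lemma gclass_add_negligible:
  "moderate z \<Longrightarrow> negligible_net d \<Longrightarrow> moderate (\<lambda>\<epsilon>. z \<epsilon> + d \<epsilon>) \<and> gclass (\<lambda>\<epsilon>. z \<epsilon> + d \<epsilon>) = gclass z"
  by (simp add: moderate_add negligible_imp_moderate gclass_eq_iff)

text \<open>Adding \<open>d\<close> to a net of points yields another representative of the same
  point, and the conditions on a defining net range over all representatives.\<close>

lemma defines_gsf_shift: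
  assumes "defines_gsf \<Omega> u X f" "negligible_net d"
  shows "defines_gsf (\<lambda>\<epsilon>. {z. z + d \<epsilon> \<in> \<Omega> \<epsilon>}) (\<lambda>\<epsilon> z. u \<epsilon> (z + d \<epsilon>)) X f"
  unfolding defines_gsf_def multi_deriv_shift
proof (intro conjI ballI allI impI)
  note def = assms(1)[unfolded defines_gsf_def]
  show "Cinf_on {z. z + d \<epsilon> \<in> \<Omega> \<epsilon>} (\<lambda>z. u \<epsilon> (z + d \<epsilon>))" "open {z. z + d \<epsilon> \<in> \<Omega> \<epsilon>}"
    if "\<epsilon> \<in> {0<..1}" for \<epsilon>
    using def that open_vimage[of "\<Omega> \<epsilon>" "\<lambda>z. z + d \<epsilon>"]
    by (auto intro!: Cinf_on_shift simp: vimage_def continuous_on_add continuous_on_id)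
  show "X \<subseteq> strongly_internal_set (\<lambda>\<epsilon>. {z. z + d \<epsilon> \<in> \<Omega> \<epsilon>})"
  proof
    fix a
    assume "a \<in> X"
    then have "a \<in> strongly_internal_set \<Omega>"
      using def by blast
    then show "a \<in> strongly_internal_set (\<lambda>\<epsilon>. {z. z + d \<epsilon> \<in> \<Omega> \<epsilon>})"
      using gclass_add_negligible[OF _ assms(2)] by (auto simp: strongly_internal_set_def)
  qed
  fix x
  assume "moderate x \<and> gclass x \<in> X"
  then have "moderate (\<lambda>\<epsilon>. x \<epsilon> + d \<epsilon>) \<and> gclass (\<lambda>\<epsilon>. x \<epsilon> + d \<epsilon>) \<in> X"
    and eq: "gclass (\<lambda>\<epsilon>. x \<epsilon> + d \<epsilon>) = gclass x"
    using gclass_add_negligible[OF _ assms(2), of x] by auto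
  then have "(\<forall>\<alpha>. moderate (\<lambda>\<epsilon>. multi_deriv \<alpha> (u \<epsilon>) (x \<epsilon> + d \<epsilon>))) \<and>
      f (gclass (\<lambda>\<epsilon>. x \<epsilon> + d \<epsilon>)) = gclass (\<lambda>\<epsilon>. u \<epsilon> (x \<epsilon> + d \<epsilon>))"
    using def by blast
  then show "moderate (\<lambda>\<epsilon>. multi_deriv \<alpha> (u \<epsilon>) (x \<epsilon> + d \<epsilon>))"
    "f (gclass x) = gclass (\<lambda>\<epsilon>. u \<epsilon> (x \<epsilon> + d \<epsilon>))" for \<alpha>
    by (auto simp: eq)
qed

text \<open>
  Changing the representative of the point amounts to translating the defining net by a
  negligible net, so independence of the representative follows from independence of the net.
\<close>

lemma gderiv_eq:
  fixes U :: "(real^'n::finite) gnum set" and f :: "(real^'n) gnum \<Rightarrow> real gnum"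
  assumes "openin sharp_topology U" "defines_gsf \<Omega> u U f" "moderate x" "gclass x \<in> U"
  shows "gderiv U \<alpha> f (gclass x) = gclass (\<lambda>\<epsilon>. multi_deriv \<alpha> (u \<epsilon>) (x \<epsilon>))"
  unfolding gderiv_def
proof (rule the_equality)
  fix c
  assume "\<exists>\<Omega>' u' y. defines_gsf \<Omega>' u' U f \<and> moderate y \<and> gclass x = gclass y \<and>
    c = gclass (\<lambda>\<epsilon>. multi_deriv \<alpha> (u' \<epsilon>) (y \<epsilon>))"
  then obtain \<Omega>' u' y where y: "defines_gsf \<Omega>' u' U f" "moderate y" "gclass x = gclass y"
    and c: "c = gclass (\<lambda>\<epsilon>. multi_deriv \<alpha> (u' \<epsilon>) (y \<epsilon>))"
    by (elim exE conjE)
  show "c = gclass (\<lambda>\<epsilon>. multi_deriv \<alpha> (u \<epsilon>) (x \<epsilon>))"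
  proof -
    define d where "d = (\<lambda>\<epsilon>. y \<epsilon> - x \<epsilon>)"
    have d: "negligible_net d"
      using y assms negligible_net_minus[of "\<lambda>\<epsilon>. x \<epsilon> - y \<epsilon>"] by (simp add: d_def gclass_eq_iff)
    have "negligible_net (\<lambda>\<epsilon>. multi_deriv \<alpha> (\<lambda>z. u' \<epsilon> (z + d \<epsilon>)) (x \<epsilon>) - multi_deriv \<alpha> (u \<epsilon>) (x \<epsilon>))"
      using multi_deriv_defining_net_unique[OF assms(1) defines_gsf_shift[OF y(1) d] assms(2-4)] .
    then have "negligible_net (\<lambda>\<epsilon>. multi_deriv \<alpha> (u' \<epsilon>) (y \<epsilon>) - multi_deriv \<alpha> (u \<epsilon>) (x \<epsilon>))"
      by (simp add: multi_deriv_shift d_def)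
    moreover have "moderate (\<lambda>\<epsilon>. multi_deriv \<alpha> (u' \<epsilon>) (y \<epsilon>))" "moderate (\<lambda>\<epsilon>. multi_deriv \<alpha> (u \<epsilon>) (x \<epsilon>))"
      using y assms unfolding defines_gsf_def by auto
    ultimately show ?thesis
      by (simp add: c gclass_eq_iff)
  qed
qed (use assms in blast)

section \<open>Norms on representatives\<close>

lemma continuous_on_abs_multi_deriv:
  fixes v :: "real^'n::finite \<Rightarrow> real"
  assumes "Cinf_on UNIV v"
  shows "continuous_on S (\<lambda>x. \<bar>multi_deriv \<alpha> v x\<bar>)"
  by (rule continuous_on_rabs, rule continuous_on_subset[OF Cinf_on_continuous[OF Cinf_on_multi_deriv[OF assms]]]) simp

text \<open>The maximum is Lipschitz, so negligible changes of the entries change it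
  negligibly.\<close>

lemma abs_Max_diff_le:
  fixes f g :: "'i \<Rightarrow> real"
  assumes "finite J" "J \<noteq> {}"
  shows "\<bar>Max (f ` J) - Max (g ` J)\<bar> \<le> (\<Sum>j\<in>J. \<bar>f j - g j\<bar>)"
proof -
  have "Max (f ` J) \<le> Max (g ` J) + (\<Sum>j\<in>J. \<bar>f j - g j\<bar>)" for f g :: "'i \<Rightarrow> real"
  proof (rule Max.boundedI)
    fix a
    assume "a \<in> f ` J"
    then obtain j where j: "j \<in> J" "a = f j"
      by blast
    have "g j \<le> Max (g ` J)" "\<bar>f j - g j\<bar> \<le> (\<Sum>j\<in>J. \<bar>f j - g j\<bar>)"
      using j assms by (auto intro: member_le_sum)
    then show "a \<le> Max (g ` J) + (\<Sum>j\<in>J. \<bar>f j - g j\<bar>)"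
      using j by linarith
  qed (use assms in auto)
  from this[of f g] this[of g f] show ?thesis
    by (simp add: abs_le_iff abs_minus_commute)
qed

lemma gMax_finite_gclass:
  assumes J: "finite J" "J \<noteq> {}"
    and s: "\<And>j. j \<in> J \<Longrightarrow> moderate (s j)" "\<And>j. j \<in> J \<Longrightarrow> F j = gclass (s j)"
  shows "moderate (\<lambda>\<epsilon>. Max ((\<lambda>j. s j \<epsilon>) ` J))" (is "moderate ?m")
    and "gMax_finite J F = gclass (\<lambda>\<epsilon>. Max ((\<lambda>j. s j \<epsilon>) ` J))"
proof -
  let ?r = "\<lambda>\<epsilon>. Max ((\<lambda>j. rep_gnum (F j) \<epsilon>) ` J)"
  \<comment> \<open>Comparison with the zero family bounds the maximum by the sum of absolute
    values.\<close>
  have zero: "Max ((\<lambda>j. 0 :: real) ` J) = 0"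
    using J by simp
  have "moderate (\<lambda>\<epsilon>. \<Sum>j\<in>J. \<bar>s j \<epsilon>\<bar>)"
    using s(1) by (intro moderate_sum) (auto simp flip: real_norm_def simp: moderate_norm_iff)
  then show m: "moderate ?m"
    by (rule moderate_le) (use abs_Max_diff_le[OF J, of "\<lambda>j. s j _" "\<lambda>_. 0"] in \<open>simp add: zero sum_nonneg\<close>)
  have "negligible_net (\<lambda>\<epsilon>. \<Sum>j\<in>J. \<bar>rep_gnum (F j) \<epsilon> - s j \<epsilon>\<bar>)"
    using s rep_gclass(2) by (intro negligible_net_sum) (auto simp flip: real_norm_def simp: negligible_net_norm_iff)
  then have neg: "negligible_net (\<lambda>\<epsilon>. ?r \<epsilon> - ?m \<epsilon>)"
    by (rule negligible_net_le) (use abs_Max_diff_le[OF J] in \<open>simp add: sum_nonneg\<close>)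
  have "moderate ?r"
    using moderate_add[OF negligible_imp_moderate[OF neg] m] by simp
  with m neg show "gMax_finite J F = gclass ?m"
    by (simp add: gMax_finite_def gclass_eq_iff)
qed

text \<open>Fixing one net of compact sets behind \<open>K\<close> turns generalized maxima into
  ordinary suprema at each index.\<close>

locale functionally_compact_subset =
  fixes U K :: "(real^'n::finite) gnum set" and A :: "real \<Rightarrow> (real^'n) set" and R :: real
  assumes open_U: "openin sharp_topology U" and K_subset_U: "K \<subseteq> U"
    and K_nonempty: "K \<noteq> {}" and K_eq: "K = internal_set A"
    and compact_A: "\<epsilon> \<in> {0<..1} \<Longrightarrow> compact (A \<epsilon>)"
    and R_pos: "R > 0" and A_bounded: "\<forall>\<^sub>F \<epsilon> in at_right 0. \<forall>x\<in>A \<epsilon>. norm x \<le> \<epsilon> powr (- R)"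
begin

text \<open>The support condition concerns a net rather than the function, hence a relation between
  the two; a net that only defines f need not satisfy it.\<close>

definition GD_net :: "(real \<Rightarrow> real^'n \<Rightarrow> real) \<Rightarrow> ((real^'n) gnum \<Rightarrow> real gnum) \<Rightarrow> bool" where
  "GD_net u f \<longleftrightarrow> defines_gsf (\<lambda>_. UNIV) u U f \<and>
     (\<forall>x \<alpha>. moderate x \<and> gclass x \<in> ext K \<longrightarrow>
        net_equiv (\<lambda>\<epsilon>. multi_deriv \<alpha> (u \<epsilon>) (x \<epsilon>)) (\<lambda>_. 0))"

text \<open>The value is meaningful only where \<open>A \<epsilon>\<close> is a non-empty compact
  set, which is the case for \<epsilon> small; the other indices do not affect the class.\<close>

definition norm_net :: "nat \<Rightarrow> (real \<Rightarrow> real^'n \<Rightarrow> real) \<Rightarrow> real \<Rightarrow> real" where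
  "norm_net m u \<epsilon> = Max ((\<lambda>\<alpha>. SUP x\<in>A \<epsilon>. \<bar>multi_deriv \<alpha> (u \<epsilon>) x\<bar>) ` multi_indices m)"

lemma GD_iff: "f \<in> GD K U \<longleftrightarrow> f \<in> extensional U \<and> (\<exists>u. GD_net u f)"
  unfolding GD_def GSF_def GD_net_def by (auto simp: PiE_def)

lemma GD_net_defines: "GD_net u f \<Longrightarrow> defines_gsf (\<lambda>_. UNIV) u U f"
  by (simp add: GD_net_def)

lemma GD_net_Cinf: "GD_net u f \<Longrightarrow> \<epsilon> \<in> {0<..1} \<Longrightarrow> Cinf_on UNIV (u \<epsilon>)"
  by (simp add: GD_net_def defines_gsf_def)

lemma GD_net_at:
  assumes "GD_net u f" "moderate x" "gclass x \<in> U"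
  shows "moderate (\<lambda>\<epsilon>. multi_deriv \<alpha> (u \<epsilon>) (x \<epsilon>))" "f (gclass x) = gclass (\<lambda>\<epsilon>. u \<epsilon> (x \<epsilon>))"
  using assms unfolding GD_net_def defines_gsf_def by auto

text \<open>Single sets \<open>A \<epsilon>\<close> may be empty, but a point of K has a
  representative that eventually lies in them.\<close>

lemma eventually_regular: "\<forall>\<^sub>F \<epsilon> in at_right 0. \<epsilon> \<in> {0<..1} \<and> A \<epsilon> \<noteq> {}"
proof -
  obtain x where "\<forall>\<^sub>F \<epsilon> in at_right 0. x \<epsilon> \<in> A \<epsilon>"
    using K_nonempty K_eq by (auto simp: internal_set_def)
  with eventually_index show ?thesis
    by eventually_elim auto
qed

text \<open>The polynomial bound on \<open>A\<close> makes every selection moderate, in particular a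
  selection of maximizers made separately at each index.\<close>

lemma internal_point:
  assumes "\<forall>\<^sub>F \<epsilon> in at_right 0. x \<epsilon> \<in> A \<epsilon>"
  shows "moderate x" "gclass x \<in> K"
proof -
  have "\<forall>\<^sub>F \<epsilon> in at_right 0. norm (x \<epsilon>) \<le> \<epsilon> powr (- R)"
    using assms A_bounded by eventually_elim auto
  then show "moderate x"
    by (rule moderateI_powr)
  then show "gclass x \<in> K"
    using assms K_eq by (auto simp: internal_set_def)
qed

lemma bdd_above_multi_deriv:
  fixes v :: "real^'n \<Rightarrow> real"
  assumes "Cinf_on UNIV v" "\<epsilon> \<in> {0<..1}"
  shows "bdd_above ((\<lambda>x. \<bar>multi_deriv \<alpha> v x\<bar>) ` A \<epsilon>)"
proof -
  have "continuous_on (A \<epsilon>) (\<lambda>x. \<bar>multi_deriv \<alpha> v x\<bar>)"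
    by (rule continuous_on_abs_multi_deriv[OF assms(1)])
  then show ?thesis
    using compact_A[OF assms(2)] by (intro bounded_imp_bdd_above compact_imp_bounded compact_continuous_image)
qed

text \<open>This universal property stands in for \<open>Max\<close> and \<open>SUP\<close> in the
  later estimates of norms.\<close>

lemma norm_net_le_iff:
  assumes "Cinf_on UNIV (u \<epsilon>)" "\<epsilon> \<in> {0<..1}" "A \<epsilon> \<noteq> {}"
  shows "norm_net m u \<epsilon> \<le> r \<longleftrightarrow> (\<forall>\<alpha>\<in>multi_indices m. \<forall>x\<in>A \<epsilon>. \<bar>multi_deriv \<alpha> (u \<epsilon>) x\<bar> \<le> r)"
proof -
  have "norm_net m u \<epsilon> \<le> r \<longleftrightarrow> (\<forall>\<alpha>\<in>multi_indices m. (SUP x\<in>A \<epsilon>. \<bar>multi_deriv \<alpha> (u \<epsilon>) x\<bar>) \<le> r)"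
    unfolding norm_net_def using finite_multi_indices zero_in_multi_indices
    by (subst Max_le_iff) auto
  then show ?thesis
    using bdd_above_multi_deriv[OF assms(1,2)] assms(3) by (simp add: cSUP_le_iff)
qed

lemma multi_deriv_le_norm_net:
  assumes "Cinf_on UNIV (u \<epsilon>)" "\<epsilon> \<in> {0<..1}" "x \<in> A \<epsilon>" "\<alpha> \<in> multi_indices m"
  shows "\<bar>multi_deriv \<alpha> (u \<epsilon>) x\<bar> \<le> norm_net m u \<epsilon>"
  using norm_net_le_iff[of u \<epsilon> m "norm_net m u \<epsilon>"] assms by auto

lemma norm_net_nonneg:
  assumes "Cinf_on UNIV (u \<epsilon>)" "\<epsilon> \<in> {0<..1}" "A \<epsilon> \<noteq> {}"
  shows "0 \<le> norm_net m u \<epsilon>"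
proof -
  obtain x where "x \<in> A \<epsilon>"
    using assms(3) by blast
  from multi_deriv_le_norm_net[where u = u and \<epsilon> = \<epsilon>, OF assms(1,2) this zero_in_multi_indices, of m] show ?thesis
    by linarith
qed

lemma gmax_on_gderiv:
  assumes "GD_net u f"
  shows "moderate (\<lambda>\<epsilon>. SUP x\<in>A \<epsilon>. \<bar>multi_deriv \<alpha> (u \<epsilon>) x\<bar>)" (is "moderate ?S")
    and "gmax_on K (\<lambda>x. gabs (gderiv U \<alpha> f x)) = gclass (\<lambda>\<epsilon>. SUP x\<in>A \<epsilon>. \<bar>multi_deriv \<alpha> (u \<epsilon>) x\<bar>)"
proof -
  let ?h = "\<lambda>x. gabs (gderiv U \<alpha> f x)"
  have h: "moderate (\<lambda>\<epsilon>. \<bar>multi_deriv \<alpha> (u \<epsilon>) (x \<epsilon>)\<bar>)"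
    "?h (gclass x) = gclass (\<lambda>\<epsilon>. \<bar>multi_deriv \<alpha> (u \<epsilon>) (x \<epsilon>)\<bar>)"
    if "moderate x" "gclass x \<in> K" for x
  proof -
    have "gclass x \<in> U"
      using that K_subset_U by blast
    then show "?h (gclass x) = gclass (\<lambda>\<epsilon>. \<bar>multi_deriv \<alpha> (u \<epsilon>) (x \<epsilon>)\<bar>)"
      using that GD_net_at[OF assms]
      by (simp add: gderiv_eq[OF open_U GD_net_defines[OF assms]] gabs_gclass)
    show "moderate (\<lambda>\<epsilon>. \<bar>multi_deriv \<alpha> (u \<epsilon>) (x \<epsilon>)\<bar>)"
      using GD_net_at(1)[OF assms that(1) \<open>gclass x \<in> U\<close>, of \<alpha>]
      by (simp flip: real_norm_def add: moderate_norm_iff)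
  qed
  have attained: "\<exists>x. x \<in> A \<epsilon> \<and> \<bar>multi_deriv \<alpha> (u \<epsilon>) x\<bar> = ?S \<epsilon>"
    and upper: "z \<in> A \<epsilon> \<Longrightarrow> \<bar>multi_deriv \<alpha> (u \<epsilon>) z\<bar> \<le> ?S \<epsilon>"
    if "\<epsilon> \<in> {0<..1} \<and> A \<epsilon> \<noteq> {}" for \<epsilon> z
  proof -
    have \<epsilon>: "\<epsilon> \<in> {0<..1}" "A \<epsilon> \<noteq> {}"
      using that by auto
    note C = GD_net_Cinf[OF assms \<epsilon>(1)]
    show "\<bar>multi_deriv \<alpha> (u \<epsilon>) z\<bar> \<le> ?S \<epsilon>" if "z \<in> A \<epsilon>" for z
      using that bdd_above_multi_deriv[OF C \<epsilon>(1)] by (rule cSUP_upper)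
    have "continuous_on (A \<epsilon>) (\<lambda>x. \<bar>multi_deriv \<alpha> (u \<epsilon>) x\<bar>)"
      by (rule continuous_on_abs_multi_deriv[OF C])
    from continuous_attains_sup[OF compact_A[OF \<epsilon>(1)] \<epsilon>(2) this]
    obtain x where x: "x \<in> A \<epsilon>" "\<And>z. z \<in> A \<epsilon> \<Longrightarrow> \<bar>multi_deriv \<alpha> (u \<epsilon>) z\<bar> \<le> \<bar>multi_deriv \<alpha> (u \<epsilon>) x\<bar>"
      by blast
    have "?S \<epsilon> \<le> \<bar>multi_deriv \<alpha> (u \<epsilon>) x\<bar>"
      using x \<epsilon>(2) by (intro cSUP_least) auto
    moreover have "\<bar>multi_deriv \<alpha> (u \<epsilon>) x\<bar> \<le> ?S \<epsilon>"
      using x(1) bdd_above_multi_deriv[OF C \<epsilon>(1)] by (rule cSUP_upper)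
    ultimately show "\<exists>x. x \<in> A \<epsilon> \<and> \<bar>multi_deriv \<alpha> (u \<epsilon>) x\<bar> = ?S \<epsilon>"
      using x(1) by force
  qed
  \<comment> \<open>Maximizers chosen index by index form one point of K, at which the generalized
    maximum is attained.\<close>
  define x0 where "x0 \<epsilon> = (SOME x. x \<in> A \<epsilon> \<and> \<bar>multi_deriv \<alpha> (u \<epsilon>) x\<bar> = ?S \<epsilon>)" for \<epsilon>
  have "\<forall>\<^sub>F \<epsilon> in at_right 0. x0 \<epsilon> \<in> A \<epsilon> \<and> \<bar>multi_deriv \<alpha> (u \<epsilon>) (x0 \<epsilon>)\<bar> = ?S \<epsilon>"
    using eventually_regular
  proof eventually_elim
    case (elim \<epsilon>)
    from someI_ex[OF attained[OF this]] show ?case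
      unfolding x0_def .
  qed
  then have x0: "\<forall>\<^sub>F \<epsilon> in at_right 0. x0 \<epsilon> \<in> A \<epsilon>"
    and eq: "\<forall>\<^sub>F \<epsilon> in at_right 0. \<bar>multi_deriv \<alpha> (u \<epsilon>) (x0 \<epsilon>)\<bar> = ?S \<epsilon>"
    by (simp_all add: eventually_conj_iff)
  note h0 = h[OF internal_point[OF x0]]
  show S: "moderate ?S"
    by (rule moderate_eventually_le[OF h0(1)]) (use eq in \<open>eventually_elim; simp\<close>)
  have h_x0: "?h (gclass x0) = gclass ?S"
    unfolding h0(2) by (rule gclass_eqI[OF h0(1) S eq])
  have max: "gle (?h a) (gclass ?S)" if "a \<in> K" for a
  proof -
    obtain y where y: "moderate y" "a = gclass y" "\<forall>\<^sub>F \<epsilon> in at_right 0. y \<epsilon> \<in> A \<epsilon>"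
      using \<open>a \<in> K\<close> K_eq by (auto simp: internal_set_def)
    have "\<forall>\<^sub>F \<epsilon> in at_right 0. \<bar>multi_deriv \<alpha> (u \<epsilon>) (y \<epsilon>)\<bar> \<le> ?S \<epsilon>"
      using eventually_regular y(3) by eventually_elim (rule upper)
    then show ?thesis
      using y(2) S h[OF internal_point[OF y(3)]] unfolding gle_def by blast
  qed
  show "gmax_on K ?h = gclass ?S"
    unfolding gmax_on_def
  proof (rule the_equality)
    show "gclass ?S \<in> ?h ` K \<and> (\<forall>x\<in>K. gle (?h x) (gclass ?S))"
      using h_x0 max internal_point(2)[OF x0] by (auto intro: rev_image_eqI)
    fix c
    assume c: "c \<in> ?h ` K \<and> (\<forall>x\<in>K. gle (?h x) c)"
    then have "gle c (gclass ?S)"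
      using max by blast
    moreover have "gle (gclass ?S) c"
      using c internal_point(2)[OF x0] h_x0 by metis
    ultimately show "c = gclass ?S"
      by (rule gle_antisym)
  qed
qed

lemma gnorm_eq:
  assumes "GD_net u f"
  shows "moderate (norm_net m u)" "gnorm K U m f = gclass (norm_net m u)"
proof -
  have "multi_indices m \<noteq> {}"
    using zero_in_multi_indices by blast
  from gMax_finite_gclass[OF finite_multi_indices this gmax_on_gderiv[OF assms]]
  show "moderate (norm_net m u)" "gnorm K U m f = gclass (norm_net m u)"
    by (simp_all add: norm_net_def[abs_def] gnorm_def)
qed

lemma gval_eq: "GD_net u f \<Longrightarrow> gval K U m f = val (gclass (norm_net m u))"
  by (simp add: gval_def gnorm_eq)

section \<open>Linear combinations\<close>

text \<open>Coefficients are nets so that one construction covers both scaling by a power of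
  \<epsilon> and differences.\<close>

definition lincomb :: "(real \<Rightarrow> real) \<Rightarrow> (real \<Rightarrow> real^'n \<Rightarrow> real) \<Rightarrow> (real \<Rightarrow> real) \<Rightarrow>
    (real \<Rightarrow> real^'n \<Rightarrow> real) \<Rightarrow> real \<Rightarrow> real^'n \<Rightarrow> real" where
  "lincomb a u b v \<epsilon> z = a \<epsilon> * u \<epsilon> z + b \<epsilon> * v \<epsilon> z"

lemma Cinf_lincomb:
  assumes "Cinf_on UNIV (u \<epsilon>)" "Cinf_on UNIV (v \<epsilon>)"
  shows "Cinf_on UNIV (lincomb a u b v \<epsilon>)"
  using Cinf_on_lincomb[OF assms] by (simp add: lincomb_def[abs_def])

lemma multi_deriv_lincomb_net:
  assumes "Cinf_on UNIV (u \<epsilon>)" "Cinf_on UNIV (v \<epsilon>)"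
  shows "multi_deriv \<alpha> (lincomb a u b v \<epsilon>) x = a \<epsilon> * multi_deriv \<alpha> (u \<epsilon>) x + b \<epsilon> * multi_deriv \<alpha> (v \<epsilon>) x"
  using multi_deriv_lincomb[OF assms] by (simp add: lincomb_def[abs_def])

lemma GD_net_lincomb:
  assumes u: "GD_net u f" and v: "GD_net v g" and ab: "moderate a" "moderate b"
  shows "GD_net (lincomb a u b v) (\<lambda>x\<in>U. gclass a * f x + gclass b * g x)"
proof -
  \<comment> \<open>Linearity holds only eventually, as \<open>u \<epsilon>\<close> and
    \<open>v \<epsilon>\<close> are known to be smooth only for indices in (0,1].\<close>
  have eq: "\<forall>\<^sub>F \<epsilon> in at_right 0. a \<epsilon> * multi_deriv \<alpha> (u \<epsilon>) (x \<epsilon>) + b \<epsilon> * multi_deriv \<alpha> (v \<epsilon>) (x \<epsilon>) =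
      multi_deriv \<alpha> (lincomb a u b v \<epsilon>) (x \<epsilon>)" for x \<alpha>
    using eventually_regular
    by eventually_elim (use multi_deriv_lincomb_net GD_net_Cinf[OF u] GD_net_Cinf[OF v] in simp)
  have "moderate (\<lambda>\<epsilon>. multi_deriv \<alpha> (lincomb a u b v \<epsilon>) (x \<epsilon>))"
    "(\<lambda>x\<in>U. gclass a * f x + gclass b * g x) (gclass x) = gclass (\<lambda>\<epsilon>. lincomb a u b v \<epsilon> (x \<epsilon>))"
    if x: "moderate x" "gclass x \<in> U" for x \<alpha>
  proof -
    have m: "moderate (\<lambda>\<epsilon>. a \<epsilon> * multi_deriv \<alpha> (u \<epsilon>) (x \<epsilon>) + b \<epsilon> * multi_deriv \<alpha> (v \<epsilon>) (x \<epsilon>))" for \<alpha>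
      using GD_net_at(1)[OF u x] GD_net_at(1)[OF v x] ab by (intro moderate_add moderate_mult)
    show "moderate (\<lambda>\<epsilon>. multi_deriv \<alpha> (lincomb a u b v \<epsilon>) (x \<epsilon>))"
      by (rule moderate_eventually_le[OF m[of \<alpha>]]) (use eq[of \<alpha> x] in \<open>eventually_elim; simp\<close>)
    have "moderate (\<lambda>\<epsilon>. u \<epsilon> (x \<epsilon>))" "moderate (\<lambda>\<epsilon>. v \<epsilon> (x \<epsilon>))"
      using GD_net_at(1)[OF u x, of "\<lambda>_. 0"] GD_net_at(1)[OF v x, of "\<lambda>_. 0"] by (simp_all add: multi_deriv_0)
    then show "(\<lambda>x\<in>U. gclass a * f x + gclass b * g x) (gclass x) = gclass (\<lambda>\<epsilon>. lincomb a u b v \<epsilon> (x \<epsilon>))"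
      using x ab GD_net_at(2)[OF u x] GD_net_at(2)[OF v x]
      by (simp add: gclass_mult gclass_add moderate_mult lincomb_def)
  qed
  moreover have "Cinf_on UNIV (lincomb a u b v \<epsilon>)" if "\<epsilon> \<in> {0<..1}" for \<epsilon>
    using that u v by (intro Cinf_lincomb GD_net_Cinf)
  moreover have "U \<subseteq> strongly_internal_set (\<lambda>_. UNIV)"
    by (auto simp: strongly_internal_set_def)
  moreover have "net_equiv (\<lambda>\<epsilon>. multi_deriv \<alpha> (lincomb a u b v \<epsilon>) (x \<epsilon>)) (\<lambda>_. 0)"
    if "moderate x" "gclass x \<in> ext K" for x \<alpha>
  proof -
    have "negligible_net (\<lambda>\<epsilon>. multi_deriv \<alpha> (u \<epsilon>) (x \<epsilon>))" "negligible_net (\<lambda>\<epsilon>. multi_deriv \<alpha> (v \<epsilon>) (x \<epsilon>))"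
      using that u v by (auto simp: GD_net_def net_equiv_def)
    then have "negligible_net (\<lambda>\<epsilon>. a \<epsilon> * multi_deriv \<alpha> (u \<epsilon>) (x \<epsilon>) + b \<epsilon> * multi_deriv \<alpha> (v \<epsilon>) (x \<epsilon>))"
      using ab by (intro negligible_net_add negligible_net_mult)
    then have "negligible_net (\<lambda>\<epsilon>. multi_deriv \<alpha> (lincomb a u b v \<epsilon>) (x \<epsilon>))"
      by (rule negligible_net_eventually_le) (use eq[of \<alpha> x] in \<open>eventually_elim; simp\<close>)
    then show ?thesis
      by (simp add: net_equiv_def moderate_const negligible_imp_moderate)
  qed
  ultimately show ?thesis
    unfolding GD_net_def defines_gsf_def by auto
qed

section \<open>Vanishing on the support\<close>

text \<open>One power of \<epsilon> below all distances to \<open>A\<close> makes the distance to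
  each point of K invertible.\<close>

lemma gclass_in_ext:
  assumes "moderate y" "\<forall>\<^sub>F \<epsilon> in at_right 0. \<forall>a\<in>A \<epsilon>. \<epsilon> powr p \<le> dist (y \<epsilon>) a"
  shows "gclass y \<in> ext K"
proof -
  have "gless 0 (gabs (gclass y - gclass a))" if "moderate a" "\<forall>\<^sub>F \<epsilon> in at_right 0. a \<epsilon> \<in> A \<epsilon>" for a
  proof -
    have "\<forall>\<^sub>F \<epsilon> in at_right 0. 0 + \<epsilon> powr p \<le> norm (y \<epsilon> - a \<epsilon>)"
      using assms(2) that(2) by eventually_elim (simp add: dist_norm)
    moreover have "moderate (\<lambda>\<epsilon>. y \<epsilon> - a \<epsilon>)"
      using assms(1) that(1) by (rule moderate_diff)
    ultimately show ?thesis
      using assms(1) that(1)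
      by (auto simp: zero_gnum.abs_eq gclass_diff gabs_gclass gless_gclass_iff moderate_const moderate_norm_iff)
  qed
  then show ?thesis
    by (auto simp: ext_def K_eq internal_set_def)
qed

text \<open>The sum of the partial derivatives in absolute value is a continuous moderate quantity,
  which suits it for the uniform bound on balls better than the operator norm.\<close>

lemma abs_derivative_le:
  fixes v :: "real^'n \<Rightarrow> real"
  assumes "(v has_derivative D) (at z)"
  shows "\<bar>D h\<bar> \<le> (\<Sum>i\<in>UNIV. \<bar>partial_deriv i v z\<bar>) * norm h"
proof -
  have "D h = D (\<Sum>i\<in>UNIV. (h $ i) *\<^sub>R axis i 1)"
    by (simp add: basis_expansion flip: scalar_mult_eq_scaleR)
  also have "\<dots> = (\<Sum>i\<in>UNIV. h $ i * partial_deriv i v z)"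
    using has_derivative_linear[OF assms]
    by (simp add: linear_sum linear_scale partial_deriv_eq[OF assms])
  also have "\<bar>\<dots>\<bar> \<le> (\<Sum>i\<in>UNIV. \<bar>partial_deriv i v z\<bar> * norm h)"
    by (rule order_trans[OF sum_abs])
      (auto intro!: sum_mono mult_right_mono simp: abs_mult mult.commute[of _ "norm h"] component_le_norm_cart)
  finally show ?thesis
    by (simp add: sum_distrib_right)
qed

text \<open>
  Indices where \<open>x\<close> is \<open>\<epsilon>\<^sup>p\<close>-close to \<open>A\<close> are handled by the mean value theorem with a gradient bound
  independent of \<open>p\<close>; at the remaining indices \<open>x\<close> agrees with a point \<open>y\<close> of \<^term>\<open>ext K\<close>, which is
  far away from \<open>A\<close> at the close indices.
\<close>

lemma GD_net_vanishes:
  assumes u: "GD_net u f" and negl: "negligible_net (norm_net m u)" and x: "moderate x" "gclass x \<in> U"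
  shows "f (gclass x) = 0"
proof -
  obtain q where q: "q > 0"
    "\<And>y. \<forall>\<^sub>F \<epsilon> in at_right 0. dist (y \<epsilon>) (x \<epsilon>) \<le> \<epsilon> powr q \<Longrightarrow> moderate y \<and> gclass y \<in> U"
    using sharp_open_obtain[OF open_U x] by blast
  define G where "G \<epsilon> z = (\<Sum>i\<in>UNIV. \<bar>partial_deriv i (u \<epsilon>) z\<bar>)" for \<epsilon> z
  have "\<forall>\<^sub>F \<epsilon> in at_right 0. continuous_on UNIV (G \<epsilon>)"
    using eventually_regular
  proof eventually_elim
    case (elim \<epsilon>)
    then show ?case
      unfolding G_def using GD_net_Cinf[OF u, of \<epsilon>]
      by (intro continuous_intros) (auto intro: Cinf_on_continuous Cinf_on_partial_deriv)
  qed
  moreover have "moderate (\<lambda>\<epsilon>. G \<epsilon> (y \<epsilon>))"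
    if "\<forall>\<^sub>F \<epsilon> in at_right 0. dist (y \<epsilon>) (x \<epsilon>) \<le> \<epsilon> powr q" for y
  proof -
    have "moderate (\<lambda>\<epsilon>. norm (partial_deriv i (u \<epsilon>) (y \<epsilon>)))" for i
      using GD_net_at(1)[OF u, of y "\<lambda>j. if j = i then 1 else 0"] q(2)[OF that]
      unfolding moderate_norm_iff multi_deriv_axis by simp
    then show ?thesis
      unfolding G_def by (intro moderate_sum) simp
  qed
  ultimately obtain N where
    N: "\<forall>\<^sub>F \<epsilon> in at_right 0. \<forall>z\<in>cball (x \<epsilon>) (\<epsilon> powr q). norm (G \<epsilon> z) \<le> \<epsilon> powr (- N)"
    using moderate_on_cball[of x q "\<lambda>_. UNIV" G] by auto
  have "negligible_net (\<lambda>\<epsilon>. u \<epsilon> (x \<epsilon>))"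
  proof (rule negligible_netI)
    fix c
    \<comment> \<open>p \<ge> q puts a nearby point of \<open>A\<close> into the ball with the
      gradient bound, and p - N \<ge> c makes the resulting increment small.\<close>
    define p where "p = max q (c + N)"
    have p: "p > 0" "p \<ge> q"
      using q(1) by (auto simp: p_def)
    obtain i :: 'n where True by blast
    \<comment> \<open>The substitute has norm \<open>2 * \<epsilon> powr (- R)\<close> while
      \<open>A\<close> lies within \<open>\<epsilon> powr (- R)\<close> of the origin, so its
      distance to \<open>A\<close> is at least \<open>\<epsilon> powr (- R)\<close>, hence at least
      \<open>\<epsilon> powr p\<close>.\<close>
    define y where "y \<epsilon> = (if \<forall>a\<in>A \<epsilon>. \<epsilon> powr p \<le> dist (x \<epsilon>) a then x \<epsilon>
      else (2 * \<epsilon> powr (- R)) *\<^sub>R axis i 1)" for \<epsilon>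
    have "moderate (\<lambda>\<epsilon>. norm (x \<epsilon>) + 2 * \<epsilon> powr (- R))"
      using x by (intro moderate_add moderate_mult moderate_const moderate_powr) (simp add: moderate_norm_iff)
    then have "moderate y"
      by (rule moderate_le) (simp add: y_def)
    moreover have "\<forall>\<^sub>F \<epsilon> in at_right 0. \<forall>a\<in>A \<epsilon>. \<epsilon> powr p \<le> dist (y \<epsilon>) a"
      using A_bounded eventually_index
    proof eventually_elim
      case (elim \<epsilon>)
      show ?case
      proof (cases "\<forall>a\<in>A \<epsilon>. \<epsilon> powr p \<le> dist (x \<epsilon>) a")
        case False
        have "\<epsilon> powr p \<le> dist (y \<epsilon>) a" if "a \<in> A \<epsilon>" for a
        proof -
          have "norm (y \<epsilon>) \<le> dist (y \<epsilon>) a + norm a"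
            using norm_triangle_ineq[of "y \<epsilon> - a" a] by (simp add: dist_norm)
          moreover have "norm (y \<epsilon>) = 2 * \<epsilon> powr (- R)"
            using False by (auto simp: y_def)
          moreover have "\<epsilon> powr p \<le> \<epsilon> powr (- R)"
            using elim R_pos p by (intro powr_mono') auto
          ultimately show ?thesis
            using elim that by fastforce
        qed
        then show ?thesis
          by blast
      qed (auto simp: y_def)
    qed
    ultimately have "net_equiv (\<lambda>\<epsilon>. multi_deriv (\<lambda>_. 0) (u \<epsilon>) (y \<epsilon>)) (\<lambda>_. 0)"
      using u gclass_in_ext[of y p] unfolding GD_net_def by blast
    then have "negligible_net (\<lambda>\<epsilon>. u \<epsilon> (y \<epsilon>))"
      by (simp add: net_equiv_def multi_deriv_0)
    from negligible_netD[OF this, of c] negligible_netD[OF negl, of c] N eventually_regular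
    have "\<forall>\<^sub>F \<epsilon> in at_right 0. norm (u \<epsilon> (x \<epsilon>)) \<le> 2 * \<epsilon> powr c"
    proof eventually_elim
      case (elim \<epsilon>)
      show ?case
      proof (cases "\<forall>a\<in>A \<epsilon>. \<epsilon> powr p \<le> dist (x \<epsilon>) a")
        case True
        then show ?thesis
          using elim by (auto simp: y_def)
      next
        case False
        then obtain a where a: "a \<in> A \<epsilon>" "dist (x \<epsilon>) a < \<epsilon> powr p"
          by force
        have Cinf: "Cinf_on UNIV (u \<epsilon>)"
          using GD_net_Cinf[OF u] elim by blast
        then obtain D where D: "\<And>z. (u \<epsilon> has_derivative D z) (at z)"
          using Cinf_on_differentiable unfolding differentiable_def by (metis UNIV_I)
        have "\<epsilon> powr p \<le> \<epsilon> powr q"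
          using elim p by (intro powr_mono') auto
        have "norm (u \<epsilon> (x \<epsilon>) - u \<epsilon> a) \<le> \<epsilon> powr (- N) * norm (x \<epsilon> - a)"
        proof (rule differentiable_bound[of "cball (x \<epsilon>) (\<epsilon> powr q)"])
          fix z
          assume z: "z \<in> cball (x \<epsilon>) (\<epsilon> powr q)"
          show "(u \<epsilon> has_derivative D z) (at z within cball (x \<epsilon>) (\<epsilon> powr q))"
            using D by (rule has_derivative_at_withinI)
          show "onorm (D z) \<le> \<epsilon> powr (- N)"
          proof (rule onorm_le)
            fix h
            have "norm (G \<epsilon> z) \<le> \<epsilon> powr (- N)"
              using elim z by blast
            then have "G \<epsilon> z \<le> \<epsilon> powr (- N)"
              by simp
            have "norm (D z h) \<le> G \<epsilon> z * norm h"
              using abs_derivative_le[OF D] by (simp add: G_def)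
            also have "\<dots> \<le> \<epsilon> powr (- N) * norm h"
              using \<open>G \<epsilon> z \<le> \<epsilon> powr (- N)\<close> by (intro mult_right_mono) auto
            finally show "norm (D z h) \<le> \<epsilon> powr (- N) * norm h" .
          qed
        qed (use a \<open>\<epsilon> powr p \<le> \<epsilon> powr q\<close> in auto)
        also have "\<dots> \<le> \<epsilon> powr (- N) * \<epsilon> powr p"
          using a by (intro mult_left_mono) (auto simp: dist_norm)
        also have "\<dots> \<le> \<epsilon> powr c"
          using elim by (auto simp: p_def simp flip: powr_add intro!: powr_mono')
        finally have "\<bar>u \<epsilon> (x \<epsilon>) - u \<epsilon> a\<bar> \<le> \<epsilon> powr c"
          by simp
        \<comment> \<open>Only the multi-index 0 enters, so the argument works for every order
          m.\<close>
        moreover have "\<bar>u \<epsilon> a\<bar> \<le> norm_net m u \<epsilon>"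
          using multi_deriv_le_norm_net[where u = u and \<epsilon> = \<epsilon>, OF Cinf _ a(1) zero_in_multi_indices] elim by (simp add: multi_deriv_0)
        ultimately show ?thesis
          using elim by (auto simp: abs_le_iff)
      qed
    qed
    then show "\<exists>C d. d \<ge> c \<and> (\<forall>\<^sub>F \<epsilon> in at_right 0. norm (u \<epsilon> (x \<epsilon>)) \<le> C * \<epsilon> powr d)"
      by blast
  qed
  then show ?thesis
    using GD_net_at[OF u x] GD_net_at(1)[OF u x, of "\<lambda>_. 0"]
    by (simp add: zero_gnum.abs_eq gclass_eq_iff moderate_const multi_deriv_0)
qed

end

section \<open>The gauges\<close>

lemma deps_mult: "deps b * deps c = deps (b + c)"
  by (simp add: deps.abs_eq gclass_mult moderate_powr powr_add)

lemma deps_0: "deps 0 = 1"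
  unfolding deps.abs_eq one_gnum.abs_eq
  by (rule gclass_eqI[OF moderate_powr moderate_const])
    (use eventually_index in \<open>eventually_elim; simp\<close>)

lemma gscale_gscale: "gscale U a (gscale U b f) = gscale U (a * b) f"
  by (auto simp: gscale_def mult.assoc)

lemma gscale_1: "f \<in> extensional U \<Longrightarrow> gscale U 1 f = f"
  by (auto simp: gscale_def fun_eq_iff extensional_def)

lemma le_minus_of_real_iff: "ereal b \<le> v - ereal c \<longleftrightarrow> ereal (b + c) \<le> v"
  by (cases v) auto

lemma less_minus_of_real_iff: "ereal b < v - ereal c \<longleftrightarrow> ereal (b + c) < v"
  by (cases v) auto

context functionally_compact_subset
begin

lemma GD_net_gscale:
  assumes "GD_net u f"
  shows "GD_net (lincomb (\<lambda>\<epsilon>. \<epsilon> powr b) u (\<lambda>_. 0) u) (gscale U (deps b) f)"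
proof -
  have "gscale U (deps b) f = (\<lambda>x\<in>U. gclass (\<lambda>\<epsilon>. \<epsilon> powr b) * f x + gclass (\<lambda>_. 0) * f x)"
    by (simp add: gscale_def deps.abs_eq flip: zero_gnum.abs_eq)
  then show ?thesis
    using GD_net_lincomb[OF assms assms moderate_powr moderate_const] by simp
qed

lemma norm_net_gscale:
  assumes "Cinf_on UNIV (u \<epsilon>)" "\<epsilon> \<in> {0<..1}" "A \<epsilon> \<noteq> {}"
  shows "norm_net m (lincomb (\<lambda>\<epsilon>. \<epsilon> powr b) u (\<lambda>_. 0) u) \<epsilon> = \<epsilon> powr b * norm_net m u \<epsilon>"
proof -
  let ?w = "lincomb (\<lambda>\<epsilon>. \<epsilon> powr b) u (\<lambda>_. 0) u"
  have "\<epsilon> powr b > 0"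
    using assms by simp
  \<comment> \<open>Both sides are shown to have the same upper bounds, which avoids moving a factor
    through \<open>Max\<close> and \<open>SUP\<close>.\<close>
  have "norm_net m ?w \<epsilon> \<le> r \<longleftrightarrow> \<epsilon> powr b * norm_net m u \<epsilon> \<le> r" for r
  proof -
    have "norm_net m ?w \<epsilon> \<le> r \<longleftrightarrow> (\<forall>\<alpha>\<in>multi_indices m. \<forall>x\<in>A \<epsilon>. \<epsilon> powr b * \<bar>multi_deriv \<alpha> (u \<epsilon>) x\<bar> \<le> r)"
      using Cinf_lincomb[where u = u and v = u, OF assms(1,1)] assms
      by (simp add: norm_net_le_iff multi_deriv_lincomb_net abs_mult)
    also have "\<dots> \<longleftrightarrow> (\<forall>\<alpha>\<in>multi_indices m. \<forall>x\<in>A \<epsilon>. \<bar>multi_deriv \<alpha> (u \<epsilon>) x\<bar> \<le> r / \<epsilon> powr b)"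
      using \<open>\<epsilon> powr b > 0\<close> by (simp add: field_simps)
    also have "\<dots> \<longleftrightarrow> norm_net m u \<epsilon> \<le> r / \<epsilon> powr b"
      using assms by (simp add: norm_net_le_iff)
    finally show ?thesis
      using \<open>\<epsilon> powr b > 0\<close> by (simp add: field_simps)
  qed
  then show ?thesis
    by (intro antisym) auto
qed

lemma gscale_in_A_set_iff:
  assumes u: "GD_net u f"
  shows "gscale U (deps b) f \<in> A_set K U n \<longleftrightarrow>
    (\<forall>r>0. \<forall>\<^sub>F \<epsilon> in at_right 0. \<epsilon> powr (b - real n) * norm_net n u \<epsilon> \<le> r)"
proof -
  let ?w = "lincomb (\<lambda>\<epsilon>. \<epsilon> powr b) u (\<lambda>_. 0) u"
  have w: "GD_net ?w (gscale U (deps b) f)"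
    by (rule GD_net_gscale[OF u])
  have "gscale U (deps b) f \<in> GD K U"
    using w by (auto simp: GD_iff gscale_def)
  then have "gscale U (deps b) f \<in> A_set K U n \<longleftrightarrow>
      infinitesimal (gclass (\<lambda>\<epsilon>. \<epsilon> powr (- real n) * norm_net n ?w \<epsilon>))"
    using gnorm_eq[OF w, of n] by (simp add: A_set_def deps.abs_eq gclass_mult moderate_powr)
  also have "gclass (\<lambda>\<epsilon>. \<epsilon> powr (- real n) * norm_net n ?w \<epsilon>) = gclass (\<lambda>\<epsilon>. \<epsilon> powr (b - real n) * norm_net n u \<epsilon>)"
  proof (rule gclass_eqI)
    show "\<forall>\<^sub>F \<epsilon> in at_right 0. \<epsilon> powr (- real n) * norm_net n ?w \<epsilon> = \<epsilon> powr (b - real n) * norm_net n u \<epsilon>"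
      using eventually_regular
    proof eventually_elim
      case (elim \<epsilon>)
      then show ?case
        using norm_net_gscale[where u = u and \<epsilon> = \<epsilon>, OF GD_net_Cinf[OF u]]
        by (simp flip: powr_add mult.assoc)
    qed
  qed (intro moderate_mult moderate_powr gnorm_eq[OF u] gnorm_eq[OF w])+
  also have "infinitesimal \<dots> \<longleftrightarrow> (\<forall>r>0. \<forall>\<^sub>F \<epsilon> in at_right 0. \<bar>\<epsilon> powr (b - real n) * norm_net n u \<epsilon>\<bar> \<le> r)"
    by (intro infinitesimal_gclass_iff moderate_mult moderate_powr gnorm_eq[OF u])
  also have "\<dots> \<longleftrightarrow> (\<forall>r>0. \<forall>\<^sub>F \<epsilon> in at_right 0. \<epsilon> powr (b - real n) * norm_net n u \<epsilon> \<le> r)"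
  proof (intro all_cong eventually_cong[OF eventually_regular])
    fix r \<epsilon> :: real
    assume "\<epsilon> \<in> {0<..1} \<and> A \<epsilon> \<noteq> {}"
    then have "0 \<le> norm_net n u \<epsilon>"
      using norm_net_nonneg[where u = u and \<epsilon> = \<epsilon>] GD_net_Cinf[OF u] by blast
    then show "\<bar>\<epsilon> powr (b - real n) * norm_net n u \<epsilon>\<bar> \<le> r \<longleftrightarrow> \<epsilon> powr (b - real n) * norm_net n u \<epsilon> \<le> r"
      by simp
  qed
  finally show ?thesis .
qed

text \<open>Scaling by \<open>deps b\<close> is undone by \<open>deps (- b)\<close>; extensionality
  makes scaling by 1 the identity outside \<open>U\<close> too.\<close>

lemma in_gscale_A_set_iff:
  assumes "f \<in> extensional U"
  shows "f \<in> gscale U (deps b) ` A_set K U n \<longleftrightarrow> gscale U (deps (- b)) f \<in> A_set K U n"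
proof
  assume "f \<in> gscale U (deps b) ` A_set K U n"
  then obtain g where g: "g \<in> A_set K U n" "f = gscale U (deps b) g"
    by blast
  then have "g \<in> extensional U"
    by (simp add: A_set_def GD_iff)
  then show "gscale U (deps (- b)) f \<in> A_set K U n"
    using g by (simp add: gscale_gscale deps_mult deps_0 gscale_1)
next
  assume "gscale U (deps (- b)) f \<in> A_set K U n"
  moreover have "f = gscale U (deps b) (gscale U (deps (- b)) f)"
    using assms by (simp add: gscale_gscale deps_mult deps_0 gscale_1)
  ultimately show "f \<in> gscale U (deps b) ` A_set K U n"
    by blast
qed

text \<open>Membership in the scaled set implies order b + n, by taking r = 1. Conversely an order
  strictly above b + n implies membership. The two suprema therefore agree although the two sets of
  exponents may differ at the end point.\<close>

lemma set_val_A_set: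
  assumes "f \<in> GD K U"
  shows "set_val U (A_set K U n) f = gval K U n f - ereal (real n)"
proof -
  obtain u where u: "GD_net u f"
    using assms GD_iff by blast
  note [simp] = gval_eq[OF u]
  have mod: "moderate (norm_net n u)"
    by (rule gnorm_eq[OF u])
  let ?B = "{b. f \<in> gscale U (deps b) ` A_set K U n}"
  have B: "b \<in> ?B \<longleftrightarrow> (\<forall>r>0. \<forall>\<^sub>F \<epsilon> in at_right 0. \<epsilon> powr (- (b + real n)) * norm_net n u \<epsilon> \<le> r)" for b
    using in_gscale_A_set_iff[of f b n] gscale_in_A_set_iff[OF u, of "- b" n] assms
    by (simp add: GD_iff algebra_simps)
  show ?thesis
    unfolding set_val_def
  proof (rule antisym)
    show "(SUP b\<in>?B. ereal b) \<le> gval K U n f - ereal (real n)"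
    proof (rule SUP_least)
      fix b
      assume "b \<in> ?B"
      then have "\<forall>\<^sub>F \<epsilon> in at_right 0. \<epsilon> powr (- (b + real n)) * norm_net n u \<epsilon> \<le> 1"
        unfolding B by simp
      with eventually_regular have "\<forall>\<^sub>F \<epsilon> in at_right 0. norm (norm_net n u \<epsilon>) \<le> 1 * \<epsilon> powr (b + real n)"
      proof eventually_elim
        case (elim \<epsilon>)
        then have "0 \<le> norm_net n u \<epsilon>"
          using norm_net_nonneg[where u = u and \<epsilon> = \<epsilon>] GD_net_Cinf[OF u] by blast
        moreover have "0 < \<epsilon> powr (b + real n)"
          using elim by simp
        ultimately show ?case
          using elim(2) unfolding powr_minus by (simp add: field_simps)
      qed
      then have "ereal (b + real n) \<le> val (gclass (norm_net n u))"
        by (intro val_gclass_ge mod net_bigoI)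
      then show "ereal b \<le> gval K U n f - ereal (real n)"
        by (simp add: le_minus_of_real_iff)
    qed
    show "gval K U n f - ereal (real n) \<le> (SUP b\<in>?B. ereal b)"
    proof (rule ereal_le_of_real_less)
      fix b
      assume "ereal b < gval K U n f - ereal (real n)"
      then have "ereal (b + real n) < val (gclass (norm_net n u))"
        by (simp add: less_minus_of_real_iff)
      then obtain c where "b + real n < c" "ereal c < val (gclass (norm_net n u))"
        using ereal_dense2 by fastforce
      then have c: "net_bigo c (norm_net n u)"
        by (intro net_bigo_less_val mod)
      \<comment> \<open>The gap between d and c absorbs the Landau constant; the gap between b + n
        and d leaves a positive power of \<epsilon>, which tends to 0.\<close>
      define d where "d = (b + real n + c) / 2"
      have d: "b + real n < d" "d < c"
        using \<open>b + real n < c\<close> by (auto simp: d_def)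
      have "b \<in> ?B"
        unfolding B
      proof (intro allI impI)
        fix r :: real
        assume "r > 0"
        then have "\<forall>\<^sub>F \<epsilon> in at_right 0. \<epsilon> powr (d - (b + real n)) \<le> r"
          using d by (intro eventually_powr_le) auto
        with net_bigoD[OF c d(2)]
        show "\<forall>\<^sub>F \<epsilon> in at_right 0. \<epsilon> powr (- (b + real n)) * norm_net n u \<epsilon> \<le> r"
        proof eventually_elim
          case (elim \<epsilon>)
          have "\<epsilon> powr (- (b + real n)) * norm_net n u \<epsilon> \<le> \<epsilon> powr (- (b + real n)) * \<epsilon> powr d"
            using elim by (intro mult_left_mono) auto
          also have "\<dots> = \<epsilon> powr (d - (b + real n))"
            by (simp flip: powr_add add: algebra_simps)
          finally show ?case
            using elim by linarith
        qed
      qed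
      then show "ereal b \<le> (SUP b\<in>?B. ereal b)"
        by (rule SUP_upper)
    qed
  qed
qed

section \<open>The two metrics\<close>

definition diff_net :: "(real \<Rightarrow> real^'n \<Rightarrow> real) \<Rightarrow> (real \<Rightarrow> real^'n \<Rightarrow> real) \<Rightarrow> real \<Rightarrow> real^'n \<Rightarrow> real" where
  "diff_net u v = lincomb (\<lambda>_. 1) u (\<lambda>_. - 1) v"

lemma GD_net_gdiff:
  assumes "GD_net u f" "GD_net v g"
  shows "GD_net (diff_net u v) (gdiff U f g)"
proof -
  have "gclass (\<lambda>_. - 1) = - (1 :: real gnum)"
    by (simp add: one_gnum.abs_eq gclass_uminus moderate_const)
  then have "gdiff U f g = (\<lambda>x\<in>U. gclass (\<lambda>_. 1) * f x + gclass (\<lambda>_. - 1) * g x)"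
    by (simp add: gdiff_def flip: one_gnum.abs_eq)
  then show ?thesis
    using GD_net_lincomb[OF assms moderate_const moderate_const] by (simp add: diff_net_def)
qed

lemma gdiff_in_GD: "f \<in> GD K U \<Longrightarrow> g \<in> GD K U \<Longrightarrow> gdiff U f g \<in> GD K U"
  using GD_net_gdiff by (fastforce simp: GD_iff gdiff_def[of U f g])

lemma norm_net_diff_le_iff:
  assumes "GD_net u f" "GD_net v g" "\<epsilon> \<in> {0<..1} \<and> A \<epsilon> \<noteq> {}"
  shows "norm_net m (diff_net u v) \<epsilon> \<le> r \<longleftrightarrow>
    (\<forall>\<alpha>\<in>multi_indices m. \<forall>x\<in>A \<epsilon>. \<bar>multi_deriv \<alpha> (u \<epsilon>) x - multi_deriv \<alpha> (v \<epsilon>) x\<bar> \<le> r)"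
proof -
  have C: "Cinf_on UNIV (u \<epsilon>)" "Cinf_on UNIV (v \<epsilon>)"
    using assms GD_net_Cinf by blast+
  show ?thesis
    using assms(3) Cinf_lincomb[where u = u and v = v, OF C]
    by (simp add: diff_net_def norm_net_le_iff multi_deriv_lincomb_net C)
qed

text \<open>The order \<open>\<epsilon> powr b\<close> is closed under sums, so a triangle
  inequality for norms becomes an ultrametric inequality for valuations.\<close>

lemma gval_gdiff_le:
  assumes "GD_net w h" "GD_net u f" "GD_net v g"
    and "\<forall>\<^sub>F \<epsilon> in at_right 0. norm_net m w \<epsilon> \<le> norm_net m u \<epsilon> + norm_net m v \<epsilon>"
  shows "min (gval K U m f) (gval K U m g) \<le> gval K U m h"
proof (rule ereal_le_of_real_less)
  fix b
  assume "ereal b < min (gval K U m f) (gval K U m g)"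
  then have "net_bigo b (norm_net m u)" "net_bigo b (norm_net m v)"
    using assms by (auto simp: gval_eq intro!: net_bigo_less_val gnorm_eq)
  then have "net_bigo b (\<lambda>\<epsilon>. norm_net m u \<epsilon> + norm_net m v \<epsilon>)"
    by (rule net_bigo_add)
  moreover have "\<forall>\<^sub>F \<epsilon> in at_right 0. norm (norm_net m w \<epsilon>) \<le> norm (norm_net m u \<epsilon> + norm_net m v \<epsilon>)"
    using assms(4) eventually_regular
  proof eventually_elim
    case (elim \<epsilon>)
    then have "0 \<le> norm_net m w \<epsilon>"
      using norm_net_nonneg[where u = w and \<epsilon> = \<epsilon>] GD_net_Cinf[OF assms(1)] by blast
    then show ?case
      using elim by simp
  qed
  ultimately have "net_bigo b (norm_net m w)"
    by (rule net_bigo_eventually_le)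
  then show "ereal b \<le> gval K U m h"
    using assms(1) by (auto simp: gval_eq intro!: val_gclass_ge gnorm_eq)
qed

lemma gval_gdiff_ultrametric:
  assumes "f \<in> GD K U" "g \<in> GD K U" "h \<in> GD K U"
  shows "min (gval K U m (gdiff U f g)) (gval K U m (gdiff U g h)) \<le> gval K U m (gdiff U f h)"
proof -
  obtain u v w where n: "GD_net u f" "GD_net v g" "GD_net w h"
    using assms GD_iff by metis
  show ?thesis
  proof (rule gval_gdiff_le[OF GD_net_gdiff[OF n(1,3)] GD_net_gdiff[OF n(1,2)] GD_net_gdiff[OF n(2,3)]])
    show "\<forall>\<^sub>F \<epsilon> in at_right 0. norm_net m (diff_net u w) \<epsilon> \<le> norm_net m (diff_net u v) \<epsilon> + norm_net m (diff_net v w) \<epsilon>"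
      using eventually_regular
    proof eventually_elim
      case (elim \<epsilon>)
      have "\<bar>multi_deriv \<alpha> (u \<epsilon>) x - multi_deriv \<alpha> (w \<epsilon>) x\<bar> \<le> norm_net m (diff_net u v) \<epsilon> + norm_net m (diff_net v w) \<epsilon>"
        if "\<alpha> \<in> multi_indices m" "x \<in> A \<epsilon>" for \<alpha> x
      proof -
        have "\<bar>multi_deriv \<alpha> (u \<epsilon>) x - multi_deriv \<alpha> (v \<epsilon>) x\<bar> \<le> norm_net m (diff_net u v) \<epsilon>"
          "\<bar>multi_deriv \<alpha> (v \<epsilon>) x - multi_deriv \<alpha> (w \<epsilon>) x\<bar> \<le> norm_net m (diff_net v w) \<epsilon>"
          using norm_net_diff_le_iff[OF n(1,2) elim] norm_net_diff_le_iff[OF n(2,3) elim] that by blast+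
        then show ?thesis
          by linarith
      qed
      then show ?case
        using norm_net_diff_le_iff[OF n(1,3) elim] by blast
    qed
  qed
qed

text \<open>Each inequality reuses \<open>gval_gdiff_le\<close> with the same net in both summands;
  the factor 2 does not affect the valuation.\<close>

lemma gval_gdiff_commute:
  assumes "f \<in> GD K U" "g \<in> GD K U"
  shows "gval K U m (gdiff U f g) = gval K U m (gdiff U g f)"
proof -
  have "gval K U m (gdiff U f g) \<le> gval K U m (gdiff U g f)" if fg: "f \<in> GD K U" "g \<in> GD K U" for f g
  proof -
    obtain u v where n: "GD_net u f" "GD_net v g"
      using fg GD_iff by metis
    have "\<forall>\<^sub>F \<epsilon> in at_right 0. norm_net m (diff_net v u) \<epsilon> \<le> norm_net m (diff_net u v) \<epsilon> + norm_net m (diff_net u v) \<epsilon>"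
      using eventually_regular
    proof eventually_elim
      case (elim \<epsilon>)
      have "norm_net m (diff_net v u) \<epsilon> \<le> norm_net m (diff_net u v) \<epsilon>"
        using norm_net_diff_le_iff[OF n elim, of m] norm_net_diff_le_iff[OF n(2,1) elim, of m]
        by (auto simp: abs_minus_commute)
      moreover have "0 \<le> norm_net m (diff_net u v) \<epsilon>"
        using norm_net_nonneg[where \<epsilon> = \<epsilon>] GD_net_Cinf[OF GD_net_gdiff[OF n]] elim by blast
      ultimately show ?case
        by linarith
    qed
    from gval_gdiff_le[OF GD_net_gdiff[OF n(2,1)] GD_net_gdiff[OF n] GD_net_gdiff[OF n] this]
    show ?thesis
      by simp
  qed
  with assms show ?thesis
    by (intro antisym) auto
qed

text \<open>Each order m separates points on its own, since the norm of order m dominates the values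
  on K.\<close>

lemma gval_gdiff_eq_infinity_iff:
  assumes "f \<in> GD K U" "g \<in> GD K U"
  shows "gval K U m (gdiff U f g) = \<infinity> \<longleftrightarrow> f = g"
proof -
  obtain u v where n: "GD_net u f" "GD_net v g"
    using assms GD_iff by metis
  note d = GD_net_gdiff[OF n]
  have iff: "gval K U m (gdiff U f g) = \<infinity> \<longleftrightarrow> negligible_net (norm_net m (diff_net u v))"
    by (simp add: gval_eq[OF d] val_eq_infinity_iff gnorm_eq[OF d])
  show ?thesis
  proof
    assume "gval K U m (gdiff U f g) = \<infinity>"
    then have negl: "negligible_net (norm_net m (diff_net u v))"
      using iff by simp
    have "f a = g a" if "a \<in> U" for a
    proof -
      obtain x where x: "moderate x" "a = gclass x"
        by (rule gnum_obtain)
      then have "gdiff U f g a = 0"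
        using GD_net_vanishes[OF d negl] that by simp
      then show ?thesis
        using that by (simp add: gdiff_def)
    qed
    then show "f = g"
      using assms by (auto simp: GD_iff intro: extensionalityI)
  next
    \<comment> \<open>The same net can then be used for both functions, and its difference with
      itself has norm 0.\<close>
    assume "f = g"
    then have n': "GD_net u g"
      using n by simp
    have "\<forall>\<^sub>F \<epsilon> in at_right 0. norm (norm_net m (diff_net u u) \<epsilon>) \<le> norm (0 :: real)"
      using eventually_regular
    proof eventually_elim
      case (elim \<epsilon>)
      have "norm_net m (diff_net u u) \<epsilon> \<le> 0"
        using norm_net_diff_le_iff[OF n' n' elim] by simp
      moreover have "0 \<le> norm_net m (diff_net u u) \<epsilon>"
        using norm_net_nonneg[where \<epsilon> = \<epsilon>] GD_net_Cinf[OF GD_net_gdiff[OF n' n']] elim by blast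
      ultimately show ?case
        by simp
    qed
    then have "negligible_net (norm_net m (diff_net u u))"
      by (rule negligible_net_eventually_le[OF negligible_net_zero])
    then show "gval K U m (gdiff U f g) = \<infinity>"
      using \<open>f = g\<close> gval_eq[OF GD_net_gdiff[OF n' n']] gnorm_eq(1)[OF GD_net_gdiff[OF n' n']]
      by (simp add: val_eq_infinity_iff)
  qed
qed

end

text \<open>A function of the valuation alone, so that its properties reduce to the finite value and
  the two infinite ones.\<close>

definition truncated_gauge :: "nat \<Rightarrow> ereal \<Rightarrow> real" where
  "truncated_gauge n v = real_of_ereal (min (exp_ereal (ereal (real n) - v)) 1)"

lemma truncated_gauge_simps:
  "truncated_gauge n (ereal r) = min (exp (real n - r)) 1"
  "truncated_gauge n \<infinity> = 0"
  "truncated_gauge n (- \<infinity>) = 1"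
  by (auto simp: truncated_gauge_def exp_ereal_def min_def one_ereal_def zero_ereal_def)

lemma truncated_gauge_nonneg: "0 \<le> truncated_gauge n v"
  and truncated_gauge_le_1: "truncated_gauge n v \<le> 1"
  by (cases v; simp add: truncated_gauge_simps)+

lemma truncated_gauge_antimono: "v \<le> w \<Longrightarrow> truncated_gauge n w \<le> truncated_gauge n v"
  by (cases v; cases w; auto simp: truncated_gauge_simps min_def)

lemma truncated_gauge_eq_0_iff: "truncated_gauge n v = 0 \<longleftrightarrow> v = \<infinity>"
  by (cases v) (auto simp: truncated_gauge_simps min_def)

text \<open>The exponential turns the minimum with 0 into a minimum with 1 and the subtraction of n
  into the weight. An infinite valuation gives 0 on both sides.\<close>

lemma exp_ereal_min_minus:
  "real_of_ereal (exp_ereal (min (ereal (real n) - v) 0 - ereal (real n))) = exp (- real n) * truncated_gauge n v"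
proof (cases v)
  case (real r)
  then show ?thesis
    by (auto simp: truncated_gauge_simps exp_ereal_def min_def zero_ereal_def exp_diff exp_minus field_simps)
qed (auto simp: truncated_gauge_simps exp_ereal_def min_def zero_ereal_def)

lemma uminus_minus_of_real: "- (v - ereal c) = ereal c - v"
  by (cases v) auto

context functionally_compact_subset
begin

text \<open>The family is indexed from 0 while the series start at n = 1, hence
  \<open>Suc k\<close>.\<close>

sublocale pseudometric_family "GD K U" "\<lambda>k f g. truncated_gauge (Suc k) (gval K U (Suc k) (gdiff U f g))"
proof
  fix k and f g h :: "(real^'n) gnum \<Rightarrow> real gnum"
  let ?v = "\<lambda>f g. gval K U (Suc k) (gdiff U f g)"
  show "0 \<le> truncated_gauge (Suc k) (?v f g)" "truncated_gauge (Suc k) (?v f g) \<le> 1"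
    by (rule truncated_gauge_nonneg truncated_gauge_le_1)+
  show "truncated_gauge (Suc k) (?v f f) = 0" if "f \<in> GD K U"
    using that by (simp add: truncated_gauge_eq_0_iff gval_gdiff_eq_infinity_iff)
  show "truncated_gauge (Suc k) (?v f g) = truncated_gauge (Suc k) (?v g f)" if "f \<in> GD K U" "g \<in> GD K U"
    using gval_gdiff_commute[OF that] by simp
  show "truncated_gauge (Suc k) (?v f h) \<le> truncated_gauge (Suc k) (?v f g) + truncated_gauge (Suc k) (?v g h)"
    if fgh: "f \<in> GD K U" "g \<in> GD K U" "h \<in> GD K U"
  proof -
    \<comment> \<open>By the ultrametric inequality, one of the two terms on the right already
      dominates the left side.\<close>
    have "?v f g \<le> ?v f h \<or> ?v g h \<le> ?v f h"
      using gval_gdiff_ultrametric[OF fgh, of "Suc k"] by (auto simp: min_le_iff_disj)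
    then have "truncated_gauge (Suc k) (?v f h) \<le> truncated_gauge (Suc k) (?v f g) \<or>
        truncated_gauge (Suc k) (?v f h) \<le> truncated_gauge (Suc k) (?v g h)"
      using truncated_gauge_antimono by blast
    then show ?thesis
      using truncated_gauge_nonneg[of "Suc k" "?v f g"] truncated_gauge_nonneg[of "Suc k" "?v g h"]
      by linarith
  qed
next
  fix f g :: "(real^'n) gnum \<Rightarrow> real gnum"
  assume "f \<in> GD K U" "g \<in> GD K U"
    and "\<And>k. truncated_gauge (Suc k) (gval K U (Suc k) (gdiff U f g)) = 0"
  then show "f = g"
    by (simp add: truncated_gauge_eq_0_iff gval_gdiff_eq_infinity_iff)
qed

lemma dist_e_eq: "dist_e K U = wdist (\<lambda>k. exp (- real (Suc k)))"
  by (intro ext) (simp add: dist_e_def wdist_def Let_def exp_ereal_min_minus del: of_nat_Suc)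

lemma truncated_gauge_val_A_set:
  "f \<in> GD K U \<Longrightarrow> real_of_ereal (min (gauge_val U (A_set K U n) f) 1) = truncated_gauge n (gval K U n f)"
  by (simp add: gauge_val_def set_val_A_set uminus_minus_of_real truncated_gauge_def)

lemma dist_2_eq: "dist_2 K U = wdist (\<lambda>k. (1 / 2) ^ Suc k)"
  by (intro ext) (simp add: dist_2_def wdist_def Let_def truncated_gauge_val_A_set gdiff_in_GD del: power_Suc)

end

theorem proposition47:
  fixes U K :: "(real^'n) gnum set"
    and u :: "(real^'n) gnum \<Rightarrow> real gnum"
  assumes "U \<noteq> {}" and "openin sharp_topology U"
    and "K \<noteq> {}" and "K \<subseteq> U" and "functionally_compact K"
    and "u \<in> GD K U"
  shows "(\<forall>n::nat>0. set_val U (A_set K U n) u = gval K U n u - ereal (real n)) \<and>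
    Metric_space (GD K U) (dist_e K U) \<and>
    Metric_space (GD K U) (dist_2 K U) \<and>
    Metric_space.mtopology (GD K U) (dist_e K U) = Metric_space.mtopology (GD K U) (dist_2 K U)"
proof -
  obtain A R where "\<forall>\<epsilon>\<in>{0<..1}. compact (A \<epsilon>)" "K = internal_set A" "R > 0"
    "\<forall>\<^sub>F \<epsilon> in at_right 0. \<forall>x\<in>A \<epsilon>. norm x \<le> \<epsilon> powr (- R)"
    using assms(5) unfolding functionally_compact_def by blast
  then interpret functionally_compact_subset U K A R
    using assms by unfold_locales auto
  have e: "exp (- real (Suc k)) > 0" "summable (\<lambda>k. exp (- real (Suc k)))" for k
  proof -
    have "(\<lambda>k. exp (- real (Suc k))) = (\<lambda>k. exp (- 1) * exp (- 1) ^ k)"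
      by (simp add: fun_eq_iff exp_of_nat_mult[symmetric] flip: exp_add)
    then show "summable (\<lambda>k. exp (- real (Suc k)))"
      by (simp add: summable_mult summable_geometric)
  qed simp
  have h: "(1 / 2 :: real) ^ Suc k > 0" "summable (\<lambda>k. (1 / 2 :: real) ^ Suc k)" for k
    by (simp_all add: summable_mult summable_geometric)
  show ?thesis
    unfolding dist_e_eq dist_2_eq
    using set_val_A_set[OF assms(6)] Metric_space_wdist[OF e] Metric_space_wdist[OF h] mtopology_wdist_eq[OF e h]
    by simp
qed

end
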